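(* Let $(M,L)$ be a Riemannian space and let $\overline L=f(e^{\sigma}L,\beta)$ be a generalized $\beta$-conformal change. If the transformed space $(M,\overline L)$ is $C_2$-like, then one of the following holds: (a) $\dim M=2$; (b) the generalized $\beta$-conformal change is an energy $\beta$-change and the transformed space $(M,\overline L)$ is Riemannian.
   Context: For an $n$-dimensional $C^\infty$ Finsler manifold $(M,L)$: $\dot\partial_i=\partial/\partial y^i$, $g_{ij}=\frac12\dot\partial_i\dot\partial_jL^2$, $y_i=g_{ij}y^j$, $C_{ijk}=\frac12\dot\partial_kg_{ij}$ (the Cartan tensor), $C_i=C_{ijk}g^{jk}$, $C^2=g^{ij}C_iC_j$. The space is Riemannian when $C_{ijk}=0$. A Finsler space of dimension $n\ge2$ is $C_2$-like when $C^2C_{ijk}=C_iC_jC_k$. A generalized $\beta$-conformal change is $L\mapsto\overline{L}=f(\widetilde L,\beta)$ with $\widetilde L=e^{\sigma(x)}L$, $\sigma$ a function on $M$, $\beta=b_i(x)y^i$ given by a 1-form on $M$, and $f$ positively homogeneous of degree one in $(\widetilde L,\beta)$; it is assumed that $(M,\overline L)$ is a Finsler space. The change is called an energy $\beta$-change if $\overline L=(k'e^{2\sigma}L^2+k\beta^2)^{1/2}$ with nonzero constants $k,k'$. Standing assumptions: $m_i:=b_i-(\beta/L^2)y_i\ne0$, $m^2:=g^{ij}m_im_j\ne0$, and $e^{\sigma}p+m^2ff_{22}\neq0$, where $p=ff_1/L$, $f_1=\partial f/\partial\widetilde L$, $f_{22}=\partial^2f/\partial\beta^2$.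
   Formalization: It is additionally assumed that f really depends on β (∂f/∂β is not identically zero on the values taken); otherwise f = e^σ L is a counterexample. The conditions m_i ≠ 0, m² ≠ 0 are required only for y not a multiple of b^i, where m_i = 0 automatically. *)

theory Defs
  imports "HOL-Analysis.Analysis"
begin

section \<open>Smooth manifolds and their tangent bundles\<close>

text \<open>\<open>C^k\<close> and \<open>C^\<infinity>\<close> maps on an \<^emph>\<open>open\<close> subset of a Euclidean space; these predicates
  are only ever used on open sets.\<close>

primrec Ck_on :: "'a::euclidean_space set \<Rightarrow> nat \<Rightarrow> ('a \<Rightarrow> 'b::real_normed_vector) \<Rightarrow> bool" where
  "Ck_on S 0 f \<longleftrightarrow> continuous_on S f"
| "Ck_on S (Suc k) f \<longleftrightarrow>
     f differentiable_on S \<and> (\<forall>i\<in>Basis. Ck_on S k (\<lambda>x. frechet_derivative f (at x) i))"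

definition smooth_on :: "'a::euclidean_space set \<Rightarrow> ('a \<Rightarrow> 'b::real_normed_vector) \<Rightarrow> bool" where
  "smooth_on S f \<longleftrightarrow> (\<forall>k. Ck_on S k f)"

type_synonym ('a, 'n) chart = "'a set \<times> ('a \<Rightarrow> real^'n)"

definition transition :: "('a, 'n::finite) chart \<Rightarrow> ('a, 'n) chart \<Rightarrow> real^'n \<Rightarrow> real^'n" where
  "transition c d = snd d \<circ> inv_into (fst c) (snd c)"

text \<open>\<open>smooth_manifold X A\<close>: \<open>X\<close> is a manifold of dimension \<open>CARD('n)\<close> with smooth atlas \<open>A\<close>
  (not assumed to be maximal, and \<open>X\<close> is not assumed to be connected).\<close>

definition smooth_manifold :: "'a topology \<Rightarrow> ('a, 'n::finite) chart set \<Rightarrow> bool" where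
  "smooth_manifold X A \<longleftrightarrow>
     Hausdorff_space X \<and> second_countable X \<and>
     (\<Union>c\<in>A. fst c) = topspace X \<and>
     (\<forall>c\<in>A. openin X (fst c) \<and> open (snd c ` fst c) \<and>
        homeomorphic_map (subtopology X (fst c)) (top_of_set (snd c ` fst c)) (snd c)) \<and>
     (\<forall>c\<in>A. \<forall>d\<in>A. smooth_on (snd c ` (fst c \<inter> fst d)) (transition c d))"

text \<open>A tangent vector at \<open>p\<close> is the family of its components in all charts around \<open>p\<close>, i.e. a
  family obeying the transformation law of vectors. It is set to 0 at the irrelevant arguments,
  so that the representation is unique and \<open>\<lambda>_. 0\<close> is the zero vector.\<close>

type_synonym ('a, 'n) tvec = "('a, 'n) chart \<Rightarrow> real^'n"

definition tangent_space :: "('a, 'n::finite) chart set \<Rightarrow> 'a \<Rightarrow> ('a, 'n) tvec set" where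
  "tangent_space A p = {v.
     (\<forall>c\<in>A. \<forall>d\<in>A. p \<in> fst c \<inter> fst d \<longrightarrow>
        v d = frechet_derivative (transition c d) (at (snd c p)) (v c)) \<and>
     (\<forall>c. \<not> (c \<in> A \<and> p \<in> fst c) \<longrightarrow> v c = 0)}"

definition tangent_bundle :: "'a topology \<Rightarrow> ('a, 'n::finite) chart set \<Rightarrow> ('a \<times> ('a, 'n) tvec) set" where
  "tangent_bundle X A = (SIGMA p:topspace X. tangent_space A p)"

definition slit_bundle :: "'a topology \<Rightarrow> ('a, 'n::finite) chart set \<Rightarrow> ('a \<times> ('a, 'n) tvec) set" where
  "slit_bundle X A = {(p, v) \<in> tangent_bundle X A. v \<noteq> (\<lambda>_. 0)}"

text \<open>The tangent vector at \<open>p\<close> whose components in the chart \<open>c\<close> are \<open>y\<close>.\<close>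

definition mk_tvec :: "('a, 'n::finite) chart set \<Rightarrow> ('a, 'n) chart \<Rightarrow> 'a \<Rightarrow> real^'n \<Rightarrow> ('a, 'n) tvec" where
  "mk_tvec A c p y = (\<lambda>d. if d \<in> A \<and> p \<in> fst d
      then frechet_derivative (transition c d) (at (snd c p)) y else 0)"

type_synonym ('a, 'n) tb_fun = "'a \<times> ('a, 'n) tvec \<Rightarrow> real"

text \<open>The restriction of a function on the tangent bundle to the fibre over \<open>p\<close>, and its full local
  expression, both in the coordinates of the chart \<open>c\<close>.\<close>

definition fibre :: "('a, 'n::finite) chart set \<Rightarrow> ('a, 'n) tb_fun \<Rightarrow> ('a, 'n) chart \<Rightarrow> 'a \<Rightarrow> real^'n \<Rightarrow> real" where
  "fibre A F c p y = F (p, mk_tvec A c p y)"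

definition local_expr :: "('a, 'n::finite) chart set \<Rightarrow> ('a, 'n) tb_fun \<Rightarrow> ('a, 'n) chart \<Rightarrow> (real^'n) \<times> (real^'n) \<Rightarrow> real" where
  "local_expr A F c = (\<lambda>(x, y). fibre A F c (inv_into (fst c) (snd c) x) y)"

definition smooth_function :: "('a, 'n::finite) chart set \<Rightarrow> ('a \<Rightarrow> real) \<Rightarrow> bool" where
  "smooth_function A \<sigma> \<longleftrightarrow> (\<forall>c\<in>A. smooth_on (snd c ` fst c) (\<sigma> \<circ> inv_into (fst c) (snd c)))"

text \<open>A 1-form is identified with the fibrewise linear function \<open>\<beta> = b\<^sub>i(x) y\<^sup>i\<close> on the tangent
  bundle that it induces.\<close>

definition one_form :: "('a, 'n::finite) chart set \<Rightarrow> ('a, 'n) tb_fun \<Rightarrow> bool" where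
  "one_form A \<beta> \<longleftrightarrow> (\<forall>c\<in>A. \<exists>b :: real^'n \<Rightarrow> real^'n. smooth_on (snd c ` fst c) b \<and>
     (\<forall>x \<in> snd c ` fst c. \<forall>y. local_expr A \<beta> c (x, y) = b x \<bullet> y))"

definition b_comp :: "('a, 'n::finite) chart set \<Rightarrow> ('a, 'n) tb_fun \<Rightarrow> ('a, 'n) chart \<Rightarrow> 'a \<Rightarrow> real^'n" where
  "b_comp A \<beta> c p = (\<chi> i. fibre A \<beta> c p (axis i 1))"


section \<open>Finsler geometry\<close>

text \<open>In the tensors below, \<open>c\<close> is a chart around \<open>p\<close> and \<open>y\<close> the components of a nonzero vector.\<close>

definition dot_partial :: "'n::finite \<Rightarrow> (real^'n \<Rightarrow> real) \<Rightarrow> real^'n \<Rightarrow> real" where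
  "dot_partial i G y = frechet_derivative G (at y) (axis i 1)"

definition g_tensor :: "('a, 'n::finite) chart set \<Rightarrow> ('a, 'n) tb_fun \<Rightarrow> ('a, 'n) chart \<Rightarrow> 'a \<Rightarrow> real^'n \<Rightarrow> real^'n^'n" where
  "g_tensor A L c p y =
     (\<chi> i j. 1/2 * dot_partial i (dot_partial j (\<lambda>z. (fibre A L c p z)\<^sup>2)) y)"

definition g_inv :: "('a, 'n::finite) chart set \<Rightarrow> ('a, 'n) tb_fun \<Rightarrow> ('a, 'n) chart \<Rightarrow> 'a \<Rightarrow> real^'n \<Rightarrow> real^'n^'n" where
  "g_inv A L c p y = matrix_inv (g_tensor A L c p y)"

definition y_lower :: "('a, 'n::finite) chart set \<Rightarrow> ('a, 'n) tb_fun \<Rightarrow> ('a, 'n) chart \<Rightarrow> 'a \<Rightarrow> real^'n \<Rightarrow> real^'n" where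
  "y_lower A L c p y = g_tensor A L c p y *v y"

definition cartan :: "('a, 'n::finite) chart set \<Rightarrow> ('a, 'n) tb_fun \<Rightarrow> ('a, 'n) chart \<Rightarrow> 'a \<Rightarrow> real^'n
    \<Rightarrow> 'n \<Rightarrow> 'n \<Rightarrow> 'n \<Rightarrow> real" where
  "cartan A L c p y i j k = 1/2 * dot_partial k (\<lambda>z. g_tensor A L c p z $ i $ j) y"

definition cartan_vec :: "('a, 'n::finite) chart set \<Rightarrow> ('a, 'n) tb_fun \<Rightarrow> ('a, 'n) chart \<Rightarrow> 'a \<Rightarrow> real^'n \<Rightarrow> real^'n" where
  "cartan_vec A L c p y =
     (\<chi> i. \<Sum>j\<in>UNIV. \<Sum>k\<in>UNIV. cartan A L c p y i j k * g_inv A L c p y $ j $ k)"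

definition norm_sq :: "('a, 'n::finite) chart set \<Rightarrow> ('a, 'n) tb_fun \<Rightarrow> ('a, 'n) chart \<Rightarrow> 'a \<Rightarrow> real^'n
    \<Rightarrow> real^'n \<Rightarrow> real" where
  "norm_sq A L c p y w = (\<Sum>i\<in>UNIV. \<Sum>j\<in>UNIV. g_inv A L c p y $ i $ j * w $ i * w $ j)"

definition finsler :: "'a topology \<Rightarrow> ('a, 'n::finite) chart set \<Rightarrow> ('a, 'n) tb_fun \<Rightarrow> bool" where
  "finsler X A L \<longleftrightarrow>
     smooth_manifold X A \<and>
     (\<forall>(p, v) \<in> slit_bundle X A. L (p, v) > 0) \<and>
     (\<forall>(p, v) \<in> tangent_bundle X A. \<forall>r\<ge>0. L (p, \<lambda>c. r *\<^sub>R v c) = r * L (p, v)) \<and>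
     (\<forall>c\<in>A. smooth_on {(x, y). x \<in> snd c ` fst c \<and> y \<noteq> 0} (local_expr A L c)) \<and>
     (\<forall>c\<in>A. \<forall>p\<in>fst c. \<forall>y. y \<noteq> 0 \<longrightarrow>
        (\<forall>z. z \<noteq> 0 \<longrightarrow> z \<bullet> (g_tensor A L c p y *v z) > 0))"

definition riemannian :: "'a topology \<Rightarrow> ('a, 'n::finite) chart set \<Rightarrow> ('a, 'n) tb_fun \<Rightarrow> bool" where
  "riemannian X A L \<longleftrightarrow> finsler X A L \<and>
     (\<forall>c\<in>A. \<forall>p\<in>fst c. \<forall>y. y \<noteq> 0 \<longrightarrow> (\<forall>i j k. cartan A L c p y i j k = 0))"

definition C2_like :: "'a topology \<Rightarrow> ('a, 'n::finite) chart set \<Rightarrow> ('a, 'n) tb_fun \<Rightarrow> bool" where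
  "C2_like X A L \<longleftrightarrow> finsler X A L \<and> CARD('n) \<ge> 2 \<and>
     (\<forall>c\<in>A. \<forall>p\<in>fst c. \<forall>y. y \<noteq> 0 \<longrightarrow> (\<forall>i j k.
        norm_sq A L c p y (cartan_vec A L c p y) * cartan A L c p y i j k =
        cartan_vec A L c p y $ i * cartan_vec A L c p y $ j * cartan_vec A L c p y $ k))"


section \<open>Generalized \<open>\<beta>\<close>-conformal changes\<close>

definition L_tilde :: "('a \<Rightarrow> real) \<Rightarrow> ('a, 'n::finite) tb_fun \<Rightarrow> ('a, 'n) tb_fun" where
  "L_tilde \<sigma> L = (\<lambda>(p, v). exp (\<sigma> p) * L (p, v))"

definition f_1 :: "(real \<Rightarrow> real \<Rightarrow> real) \<Rightarrow> real \<Rightarrow> real \<Rightarrow> real" where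
  "f_1 f s t = deriv (\<lambda>u. f u t) s"

definition f_2 :: "(real \<Rightarrow> real \<Rightarrow> real) \<Rightarrow> real \<Rightarrow> real \<Rightarrow> real" where
  "f_2 f s t = deriv (\<lambda>u. f s u) t"

definition f_22 :: "(real \<Rightarrow> real \<Rightarrow> real) \<Rightarrow> real \<Rightarrow> real \<Rightarrow> real" where
  "f_22 f = f_2 (f_2 f)"

text \<open>\<open>W\<close> is the domain of \<open>f\<close>: an open cone which contains all the values of \<open>(e\<^sup>\<sigma> L, \<beta>)\<close>, but not
  necessarily the whole half-plane (think of a Randers or a Matsumoto metric).\<close>

definition gen_beta_conformal_change ::
  "'a topology \<Rightarrow> ('a, 'n::finite) chart set \<Rightarrow> ('a \<Rightarrow> real) \<Rightarrow> ('a, 'n) tb_fun \<Rightarrow> (real \<times> real) set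
    \<Rightarrow> (real \<Rightarrow> real \<Rightarrow> real) \<Rightarrow> ('a, 'n) tb_fun \<Rightarrow> ('a, 'n) tb_fun \<Rightarrow> bool" where
  "gen_beta_conformal_change X A \<sigma> \<beta> W f L L' \<longleftrightarrow>
     finsler X A L \<and> finsler X A L' \<and> smooth_function A \<sigma> \<and> one_form A \<beta> \<and>
     open W \<and> smooth_on W (\<lambda>(s, t). f s t) \<and>
     (\<forall>(s, t) \<in> W. \<forall>r>0. (r * s, r * t) \<in> W \<and> f (r * s) (r * t) = r * f s t) \<and>
     (\<forall>w \<in> slit_bundle X A. (L_tilde \<sigma> L w, \<beta> w) \<in> W \<and> L' w = f (L_tilde \<sigma> L w) (\<beta> w))"

definition energy_beta_change ::
  "'a topology \<Rightarrow> ('a, 'n::finite) chart set \<Rightarrow> ('a \<Rightarrow> real) \<Rightarrow> ('a, 'n) tb_fun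
    \<Rightarrow> ('a, 'n) tb_fun \<Rightarrow> ('a, 'n) tb_fun \<Rightarrow> bool" where
  "energy_beta_change X A \<sigma> \<beta> L L' \<longleftrightarrow> (\<exists>k k'. k \<noteq> 0 \<and> k' \<noteq> 0 \<and>
     (\<forall>(p, v) \<in> tangent_bundle X A.
        L' (p, v) = sqrt (k' * exp (2 * \<sigma> p) * (L (p, v))\<^sup>2 + k * (\<beta> (p, v))\<^sup>2)))"

definition m_form :: "('a, 'n::finite) chart set \<Rightarrow> ('a, 'n) tb_fun \<Rightarrow> ('a, 'n) tb_fun
    \<Rightarrow> ('a, 'n) chart \<Rightarrow> 'a \<Rightarrow> real^'n \<Rightarrow> real^'n" where
  "m_form A L \<beta> c p y =
     b_comp A \<beta> c p - (fibre A \<beta> c p y / (fibre A L c p y)\<^sup>2) *\<^sub>R y_lower A L c p y"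

definition p_coeff :: "('a \<Rightarrow> real) \<Rightarrow> ('a, 'n::finite) tb_fun \<Rightarrow> (real \<Rightarrow> real \<Rightarrow> real)
    \<Rightarrow> ('a, 'n) tb_fun \<Rightarrow> ('a, 'n) tb_fun" where
  "p_coeff \<sigma> \<beta> f L w = f (L_tilde \<sigma> L w) (\<beta> w) * f_1 f (L_tilde \<sigma> L w) (\<beta> w) / L w"

text \<open>The standing assumptions. If \<open>y\<close> is a multiple of \<open>b\<^sup>i = g\<^sup>i\<^sup>j b\<^sub>j\<close> and \<open>g\<close> is Riemannian, then
  \<open>m\<^sub>i = 0\<close> identically; a Finsler function being smooth on the whole slit tangent bundle, such
  directions always exist when \<open>b \<noteq> 0\<close>. So \<open>m\<^sub>i \<noteq> 0\<close> and \<open>m\<^sup>2 \<noteq> 0\<close> are required in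
  all the other directions. At a point where \<open>b = 0\<close> no \<open>y \<noteq> 0\<close> is exempt, so that
  these conditions fail there.\<close>

definition standing_assumptions ::
  "('a, 'n::finite) chart set \<Rightarrow> ('a \<Rightarrow> real) \<Rightarrow> ('a, 'n) tb_fun
    \<Rightarrow> (real \<Rightarrow> real \<Rightarrow> real) \<Rightarrow> ('a, 'n) tb_fun \<Rightarrow> bool" where
  "standing_assumptions A \<sigma> \<beta> f L \<longleftrightarrow> (\<forall>c\<in>A. \<forall>p\<in>fst c. \<forall>y. y \<noteq> 0 \<longrightarrow>
     ((\<nexists>r. y = r *\<^sub>R (g_inv A L c p y *v b_comp A \<beta> c p)) \<longrightarrow>
        m_form A L \<beta> c p y \<noteq> 0 \<and> norm_sq A L c p y (m_form A L \<beta> c p y) \<noteq> 0) \<and>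
     (let w = (p, mk_tvec A c p y); s = L_tilde \<sigma> L w; t = \<beta> w in
        exp (\<sigma> p) * p_coeff \<sigma> \<beta> f L w
          + norm_sq A L c p y (m_form A L \<beta> c p y) * f s t * f_22 f s t \<noteq> 0))"

text \<open>\<open>f\<close> is not a function of its first argument alone on the values of \<open>(e\<^sup>\<sigma> L, \<beta>)\<close>. If it is,
  the change is a homothety composed with a conformal change, and \<open>\<beta>\<close> plays no role.\<close>

definition depends_on_beta ::
  "'a topology \<Rightarrow> ('a, 'n::finite) chart set \<Rightarrow> ('a \<Rightarrow> real) \<Rightarrow> ('a, 'n) tb_fun
    \<Rightarrow> (real \<Rightarrow> real \<Rightarrow> real) \<Rightarrow> ('a, 'n) tb_fun \<Rightarrow> bool" where
  "depends_on_beta X A \<sigma> \<beta> f L \<longleftrightarrow> (\<exists>w \<in> slit_bundle X A. f_2 f (L_tilde \<sigma> L w) (\<beta> w) \<noteq> 0)"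

end

theory Submission
  imports Defs
begin

text \<open>Fix a point and a chart. Since \<open>L\<close> is Riemannian, its square is a quadratic form on the fibre; with
\<open>q(y) = e\<^sup>2\<^sup>\<sigma> L\<^sup>2\<close> and \<open>\<tau> = \<beta> / \<surd>q\<close>, homogeneity of \<open>f\<close> turns \<open>L'\<^sup>2\<close> into
\<open>q h(\<tau>)\<close> with \<open>h(x) = f(1, x)\<^sup>2\<close>, a one-variable profile common to all points. Everything is
decided by this profile.

Write \<open>G\<close> for the matrix of \<open>q\<close>, \<open>w = h'/2\<close>, \<open>v = w - \<tau> w'\<close>, and \<open>H\<close> for the angular metric of \<open>G\<close>,
that is \<open>G\<close> minus its part along \<open>y\<close>. Differentiating three times gives
\<open>2 \<surd>q C\<^sub>i\<^sub>j\<^sub>k = v (H\<^sub>i\<^sub>j m\<^sub>k + H\<^sub>i\<^sub>k m\<^sub>j + H\<^sub>j\<^sub>k m\<^sub>i) + w'' m\<^sub>i m\<^sub>j m\<^sub>k\<close> (lemma \<open>cartan_tensor_E\<close>). In dimension at least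
three there is a vector \<open>z \<noteq> 0\<close> orthogonal to \<open>y\<close> and to \<open>b\<close>. Contracting the \<open>C2\<close>-like equation with
\<open>z\<close> three times gives \<open>C\<^sub>i z\<^sup>i = 0\<close>, and contracting it with \<open>z\<close> twice then gives \<open>C\<^sup>2 v m\<^sub>i = 0\<close>. So either \<open>v = 0\<close>, or
\<open>C\<^sup>2 = 0\<close> and hence \<open>C\<^sub>i = 0\<close> by positive definiteness. In the second case the trace of the Cartan
tensor yields \<open>K v + (B\<^sup>2 - \<tau>\<^sup>2) w'' = 0\<close> with some \<open>K \<ge> 3\<close>, where \<open>B\<close> is the norm of \<open>b\<close>
(lemma \<open>C2_like_ode\<close>).

The alternative may vary with \<open>y\<close>, but in both cases \<open>(B\<^sup>2 - \<tau>\<^sup>2) v v' = K \<tau> v\<^sup>2\<close>, because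
\<open>v' = - \<tau> w''\<close>. Thus \<open>v\<^sup>2\<close> grows with \<open>\<bar>\<tau>\<bar>\<close>, whereas letting \<open>\<bar>\<tau>\<bar> \<rightarrow> B\<close> forces \<open>v(\<plusminus>B) = 0\<close>. This is
where it matters that the Finsler function is smooth in all directions, including those of \<open>\<plusminus>b\<close>,
and that \<open>b \<noteq> 0\<close>, which the standing assumptions provide. Hence \<open>v = 0\<close> and \<open>w'' = 0\<close>, so the Cartan
tensor vanishes and \<open>h(x) = h(0) + w'(0) x\<^sup>2\<close> (lemma \<open>ode_forces_quadratic\<close>). The constants are
values of the profile at \<open>0\<close>, hence the same at every point of the manifold: this is an energy
change with \<open>k' = h(0)\<close> and \<open>k = w'(0)\<close>, and \<open>k\<close> is nonzero because \<open>f\<close> depends on \<open>\<beta>\<close>.\<close>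

section \<open>Smooth functions on open sets\<close>

lemma differentiable_on_open_has_derivative:
  assumes "f differentiable_on S" "open S" "x \<in> S"
  shows "(f has_derivative frechet_derivative f (at x)) (at x)"
  using assms by (simp add: differentiable_on_eq_differentiable_at frechet_derivative_works)

lemma Ck_on_cong:
  assumes "open S" "\<And>x. x \<in> S \<Longrightarrow> f x = g x" "Ck_on S k f"
  shows "Ck_on S k g"
  using assms(2,3)
proof (induction k arbitrary: f g)
  case 0
  then show ?case by (auto cong: continuous_on_cong)
next
  case (Suc k)
  have eq: "frechet_derivative f (at x) = frechet_derivative g (at x)" if "x \<in> S" for x
    using Suc.prems that assms(1)
    by (intro frechet_derivative_transform_within_open[where X = S])
      (auto simp: differentiable_on_eq_differentiable_at)
  have "g differentiable_on S"
    using Suc.prems assms(1)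
    by (auto simp: differentiable_on_def intro: differentiable_transform_within[OF _ zero_less_one])
  then show ?case
    using Suc.prems eq by (auto intro: Suc.IH[of "\<lambda>x. frechet_derivative f (at x) _"])
qed

lemma smooth_on_imp_continuous_on: "smooth_on S f \<Longrightarrow> continuous_on S f"
  unfolding smooth_on_def by (metis Ck_on.simps(1))

lemma smooth_on_imp_differentiable_on: "smooth_on S f \<Longrightarrow> f differentiable_on S"
  unfolding smooth_on_def by (metis Ck_on.simps(2))

lemma smooth_on_has_derivative:
  assumes "smooth_on S f" "open S" "x \<in> S"
  shows "(f has_derivative frechet_derivative f (at x)) (at x)"
  using assms smooth_on_imp_differentiable_on differentiable_on_open_has_derivative by blast

lemma smooth_on_partial:
  assumes "smooth_on S f" "i \<in> Basis"
  shows "smooth_on S (\<lambda>x. frechet_derivative f (at x) i)"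
  using assms unfolding smooth_on_def by (metis Ck_on.simps(2))

lemma smooth_on_dot_partial:
  assumes "smooth_on S F"
  shows "smooth_on S (dot_partial i F)"
  using smooth_on_partial[OF assms, of "axis i 1"] unfolding dot_partial_def by auto

lemma smooth_on_const: "smooth_on S (\<lambda>_. c)"
proof -
  have "Ck_on S k (\<lambda>_. c)" for k by (induction k arbitrary: c) auto
  then show ?thesis by (simp add: smooth_on_def)
qed

lemma has_derivative_slice:
  assumes "(F has_derivative F') (at (x, y))"
  shows "((\<lambda>y. F (x, y)) has_derivative (\<lambda>d. F' (0, d))) (at y)"
  using has_derivative_compose[OF has_derivative_Pair[OF has_derivative_const has_derivative_ident] assms] .

text \<open>Both the fibre restriction of a Finsler function, which is smooth in position and direction
jointly, and the profile \<open>f(1, \<cdot>)\<close> are slices of smooth functions of two variables.\<close>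

lemma Ck_on_slice:
  fixes S :: "('b::euclidean_space \<times> 'c::euclidean_space) set"
  assumes "open S" "Ck_on S k F"
  shows "Ck_on {y. (x, y) \<in> S} k (\<lambda>y. F (x, y))"
  using assms(2)
proof (induction k arbitrary: F)
  case 0
  then show ?case by (auto intro!: continuous_on_compose2[where f = "Pair x"] continuous_intros)
next
  case (Suc k)
  have opn: "open {y. (x, y) \<in> S}"
    using open_vimage[OF assms(1), of "Pair x"] by (auto simp: vimage_def continuous_intros)
  have der: "((\<lambda>y. F (x, y)) has_derivative (\<lambda>d. frechet_derivative F (at (x, y)) (0, d))) (at y)"
    if "(x, y) \<in> S" for y
    using Suc.prems that assms(1) by (auto intro!: has_derivative_slice differentiable_on_open_has_derivative)
  then have eq: "frechet_derivative (\<lambda>y. F (x, y)) (at y) i = frechet_derivative F (at (x, y)) (0, i)"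
    if "(x, y) \<in> S" for y i
    using that by (metis frechet_derivative_at)
  have "Ck_on {y. (x, y) \<in> S} k (\<lambda>y. frechet_derivative (\<lambda>y. F (x, y)) (at y) i)"
    if "i \<in> Basis" for i
  proof -
    have "(0, i) \<in> (Basis :: ('b \<times> 'c) set)"
      using that by (auto simp: Basis_prod_def)
    then have "Ck_on {y. (x, y) \<in> S} k (\<lambda>y. frechet_derivative F (at (x, y)) (0, i))"
      using Suc.prems by (intro Suc.IH) auto
    then show ?thesis
      by (rule Ck_on_cong[OF opn, rotated]) (simp add: eq)
  qed
  moreover have "(\<lambda>y. F (x, y)) differentiable_on {y. (x, y) \<in> S}"
    using der by (auto simp: differentiable_on_eq_differentiable_at[OF opn] differentiable_def)
  ultimately show ?case by simp
qed

lemma smooth_on_slice: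
  fixes S :: "('b::euclidean_space \<times> 'c::euclidean_space) set"
  assumes "open S" "smooth_on S F"
  shows "smooth_on {y. (x, y) \<in> S} (\<lambda>y. F (x, y))"
  using assms Ck_on_slice unfolding smooth_on_def by blast

lemma Ck_on_add:
  fixes f g :: "'b::euclidean_space \<Rightarrow> 'c::real_normed_vector"
  assumes "open S" "Ck_on S k f" "Ck_on S k g"
  shows "Ck_on S k (\<lambda>x. f x + g x)"
  using assms(2,3)
proof (induction k arbitrary: f g)
  case 0
  then show ?case by (simp add: continuous_on_add)
next
  case (Suc k)
  have eq: "frechet_derivative f (at x) i + frechet_derivative g (at x) i
      = frechet_derivative (\<lambda>x. f x + g x) (at x) i" if "x \<in> S" for x i
  proof -
    have "((\<lambda>x. f x + g x) has_derivative
        (\<lambda>d. frechet_derivative f (at x) d + frechet_derivative g (at x) d)) (at x)"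
      using Suc.prems assms(1) that by (intro has_derivative_add differentiable_on_open_has_derivative) auto
    from fun_cong[OF frechet_derivative_at[OF this]] show ?thesis .
  qed
  have "Ck_on S k (\<lambda>x. frechet_derivative (\<lambda>x. f x + g x) (at x) i)" if "i \<in> Basis" for i
    by (rule Ck_on_cong[OF assms(1) eq], assumption, rule Suc.IH) (use Suc.prems that in simp_all)
  then show ?case using Suc.prems by (simp add: differentiable_on_add)
qed

text \<open>The product rule expresses the partial derivatives of a product by products of smooth functions
again, so the induction on the order has to range over all pairs of smooth factors.\<close>

lemma smooth_on_mult:
  fixes f g :: "'b::euclidean_space \<Rightarrow> real"
  assumes "open S" "smooth_on S f" "smooth_on S g"
  shows "smooth_on S (\<lambda>x. f x * g x)"
proof -
  have "Ck_on S k (\<lambda>x. f x * g x)" for k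
    using assms(2,3)
  proof (induction k arbitrary: f g)
    case 0
    then show ?case by (simp add: continuous_on_mult smooth_on_imp_continuous_on)
  next
    case (Suc k)
    have eq: "f x * frechet_derivative g (at x) i + frechet_derivative f (at x) i * g x
        = frechet_derivative (\<lambda>x. f x * g x) (at x) i" if "x \<in> S" for x i
    proof -
      have "((\<lambda>x. f x * g x) has_derivative
          (\<lambda>d. f x * frechet_derivative g (at x) d + frechet_derivative f (at x) d * g x)) (at x)"
        by (intro has_derivative_mult smooth_on_has_derivative[OF _ assms(1) that] Suc.prems)
      from fun_cong[OF frechet_derivative_at[OF this]] show ?thesis .
    qed
    have "Ck_on S k (\<lambda>x. frechet_derivative (\<lambda>x. f x * g x) (at x) i)" if "i \<in> Basis" for i
      by (rule Ck_on_cong[OF assms(1) eq], assumption)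
        (intro Ck_on_add assms(1) Suc.IH smooth_on_partial Suc.prems that)
    then show ?case
      using Suc.prems by (simp add: differentiable_on_mult smooth_on_imp_differentiable_on)
  qed
  then show ?thesis by (simp add: smooth_on_def)
qed

lemma smooth_on_has_real_derivative:
  assumes "smooth_on S \<phi>" "open S" "x \<in> S"
  shows "(\<phi> has_real_derivative frechet_derivative \<phi> (at x) 1) (at x)"
proof -
  note der = smooth_on_has_derivative[OF assms]
  have "frechet_derivative \<phi> (at x) 1 * r = frechet_derivative \<phi> (at x) r" for r
    using linear_scale[OF has_derivative_linear[OF der], of r 1] by (metis mult.commute mult.right_neutral real_scaleR_def)
  then have "(*) (frechet_derivative \<phi> (at x) 1) = frechet_derivative \<phi> (at x)" by (rule ext)
  then show ?thesis using der by (simp only: has_field_derivative_def)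
qed

section \<open>Matrices and quadratic forms\<close>

lemma inner_matrix_vector:
  "x \<bullet> ((M :: real^'n::finite^'n) *v y) = (\<Sum>i\<in>UNIV. \<Sum>j\<in>UNIV. x $ i * y $ j * M $ i $ j)"
  by (simp add: inner_vec_def matrix_vector_mult_def sum_distrib_left mult_ac)

lemma inner_matrix_vector_commute:
  assumes "transpose (M :: real^'n::finite^'n) = M"
  shows "x \<bullet> (M *v y) = y \<bullet> (M *v x)"
  using assms by (metis dot_lmul_matrix inner_commute vector_transpose_matrix)

lemma has_derivative_matrix_vector [derivative_intros]:
  "((\<lambda>y. (M :: real^'n::finite^'n) *v y) has_derivative (\<lambda>d. M *v d)) (at y within S)"
  by (simp add: bounded_linear_imp_has_derivative matrix_vector_mul_bounded_linear)

lemma matrix_vector_axis_nth: "((M :: real^'n::finite^'n) *v axis k 1) $ i = M $ i $ k"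
  by (simp add: matrix_vector_mul_component inner_axis)

lemma has_derivative_matrix_vector_nth:
  "((\<lambda>y. ((M :: real^'n::finite^'n) *v y) $ i) has_derivative (\<lambda>d. (M *v d) $ i)) (at y within S)"
  by (rule bounded_linear.has_derivative[OF bounded_linear_vec_nth has_derivative_matrix_vector])

lemma positive_definite_invertible:
  assumes "\<And>z. z \<noteq> 0 \<Longrightarrow> z \<bullet> ((M :: real^'n::finite^'n) *v z) > 0"
  shows "invertible M"
proof -
  have "x = 0" if "M *v x = 0" for x
    using assms[of x] that by fastforce
  then show ?thesis
    unfolding invertible_left_inverse matrix_left_invertible_ker by blast
qed

lemma exists_orthogonal_to_pair:
  fixes x y :: "real^'n::finite"
  assumes "CARD('n) \<ge> 3"
  obtains z where "z \<noteq> 0" "x \<bullet> z = 0" "y \<bullet> z = 0"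
proof -
  have "dim {x, y} \<le> card {x, y}" by (rule dim_le_card') simp
  also have "\<dots> \<le> 2" by (simp add: card_insert_if)
  finally have "dim {x, y} < DIM(real^'n)" using assms by simp
  then obtain z where z: "z \<noteq> 0" "\<And>a. a \<in> span {x, y} \<Longrightarrow> orthogonal z a"
    using orthogonal_to_subspace_exists by blast
  have "x \<in> span {x, y}" "y \<in> span {x, y}" by (auto intro!: span_base)
  from z(2)[OF this(1)] z(2)[OF this(2)] show thesis
    by (intro that[OF z(1)]) (simp_all add: orthogonal_def inner_commute)
qed

lemma
  assumes "invertible (M :: real^'n::finite^'n)"
  shows matrix_inv_right: "M ** matrix_inv M = mat 1" and matrix_inv_left: "matrix_inv M ** M = mat 1"
  using assms unfolding invertible_def matrix_inv_def by (metis (mono_tags, lifting) someI_ex)+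

lemma matrix_inv_apply:
  assumes "invertible (M :: real^'n::finite^'n)"
  shows "matrix_inv M *v (M *v x) = x"
  by (simp add: matrix_vector_mul_assoc matrix_inv_left[OF assms])

text \<open>The trace of the identity, in the index form in which it enters the contracted Cartan tensor.\<close>

lemma contract_matrix_inv:
  assumes "transpose (M :: real^'n::finite^'n) = M" "invertible M"
  shows "(\<Sum>j\<in>UNIV. \<Sum>k\<in>UNIV. M $ j $ k * matrix_inv M $ j $ k) = CARD('n)"
proof -
  have "(\<Sum>j\<in>UNIV. \<Sum>k\<in>UNIV. M $ j $ k * matrix_inv M $ j $ k) = trace (matrix_inv M ** M)"
    using assms(1) by (auto simp: trace_def matrix_matrix_mult_def transpose_def vec_eq_iff mult.commute intro!: sum.cong)
  also have "\<dots> = CARD('n)" by (simp add: matrix_inv_left[OF assms(2)] trace_I)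
  finally show ?thesis .
qed

lemma contract_rank_one:
  "(\<Sum>j\<in>UNIV. \<Sum>k\<in>UNIV. x $ j * x $ k * (N :: real^'n::finite^'n) $ j $ k) = x \<bullet> (N *v x)"
  by (simp add: inner_matrix_vector)

section \<open>Fundamental tensor and Cartan tensor of a function on a vector space\<close>

lemma dot_partial_eqI:
  assumes "(F has_derivative F') (at y)"
  shows "dot_partial i F y = F' (axis i 1)"
  unfolding dot_partial_def using fun_cong[OF frechet_derivative_at[OF assms]] by simp

lemma dot_partial_cong:
  assumes "open S" "y \<in> S" "\<And>z. z \<in> S \<Longrightarrow> F z = G z"
  shows "dot_partial i F y = dot_partial i G y"
proof -
  have *: "(F has_derivative D) (at y) \<longleftrightarrow> (G has_derivative D) (at y)" for D
    using assms has_derivative_transform_within_open[OF _ assms(1,2), of F D UNIV G]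
      has_derivative_transform_within_open[OF _ assms(1,2), of G D UNIV F]
    by auto
  show ?thesis
    unfolding dot_partial_def frechet_derivative_def by (simp add: *)
qed

lemma frechet_derivative_dot_partial:
  assumes "(F has_derivative F') (at y)"
  shows "F' d = (\<Sum>i\<in>UNIV. d $ i * dot_partial i F y)"
proof -
  have lin: "linear F'" using assms has_derivative_linear by blast
  have "F' d = F' (\<Sum>i\<in>UNIV. d $ i *\<^sub>R axis i 1)"
    by (simp add: basis_expansion flip: scalar_mult_eq_scaleR)
  also have "\<dots> = (\<Sum>i\<in>UNIV. d $ i * F' (axis i 1))"
    by (simp add: linear_sum[OF lin] linear_scale[OF lin])
  finally show ?thesis by (simp add: dot_partial_eqI[OF assms])
qed

text \<open>The tensors \<open>g\<^sub>i\<^sub>j\<close> and \<open>C\<^sub>i\<^sub>j\<^sub>k\<close> in terms of the squared Finsler function \<open>E = L\<^sup>2\<close> on a single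
fibre; the results on one fibre need no manifold.\<close>

definition fundamental_tensor :: "(real^'n::finite \<Rightarrow> real) \<Rightarrow> real^'n \<Rightarrow> real^'n^'n" where
  "fundamental_tensor E y = (\<chi> i j. 1/2 * dot_partial i (dot_partial j E) y)"

definition cartan_tensor :: "(real^'n::finite \<Rightarrow> real) \<Rightarrow> real^'n \<Rightarrow> 'n \<Rightarrow> 'n \<Rightarrow> 'n \<Rightarrow> real" where
  "cartan_tensor E y i j k = 1/2 * dot_partial k (\<lambda>z. fundamental_tensor E z $ i $ j) y"

lemma fundamental_tensor_cong:
  assumes "open S" "y \<in> S" "\<And>z. z \<in> S \<Longrightarrow> E z = E' z"
  shows "fundamental_tensor E y = fundamental_tensor E' y"
proof -
  have "dot_partial j E z = dot_partial j E' z" if "z \<in> S" for z j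
    by (rule dot_partial_cong[OF assms(1) that assms(3)])
  from dot_partial_cong[OF assms(1,2) this] show ?thesis
    unfolding fundamental_tensor_def vec_eq_iff by simp
qed

lemma cartan_tensor_cong:
  assumes "open S" "y \<in> S" "\<And>z. z \<in> S \<Longrightarrow> E z = E' z"
  shows "cartan_tensor E y i j k = cartan_tensor E' y i j k"
proof -
  have "fundamental_tensor E z = fundamental_tensor E' z" if "z \<in> S" for z
    by (rule fundamental_tensor_cong[OF assms(1) that assms(3)])
  then show ?thesis
    unfolding cartan_tensor_def by (intro arg_cong2[where f = times] refl dot_partial_cong[OF assms(1,2)]) simp
qed

text \<open>A vanishing Cartan tensor makes the Hessian of \<open>F\<^sup>2\<close> constant on the punctured space, which is
connected from dimension two on. Since \<open>F\<^sup>2\<close> is homogeneous of degree two, Euler's relation recovers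
it from this Hessian. Symmetry of \<open>G\<close> then follows from the quadratic form, without Schwarz's
theorem.\<close>

lemma Riemannian_fibre_quadratic:
  fixes F :: "real^'n::finite \<Rightarrow> real"
  assumes n: "CARD('n) \<ge> 2" and sm: "smooth_on (-{0}) F"
    and hom: "\<And>r y. r \<ge> 0 \<Longrightarrow> F (r *\<^sub>R y) = r * F y"
    and cartan0: "\<And>y i j k. y \<noteq> 0 \<Longrightarrow> cartan_tensor (\<lambda>z. (F z)\<^sup>2) y i j k = 0"
  obtains G where "\<And>y. y \<noteq> 0 \<Longrightarrow> fundamental_tensor (\<lambda>z. (F z)\<^sup>2) y = G"
    "\<And>y. (F y)\<^sup>2 = y \<bullet> (G *v y)" "transpose G = G"
proof -
  let ?S = "-{0 :: real^'n}"
  define E where "E = (\<lambda>z. (F z)\<^sup>2)"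
  have opn: "open ?S" by auto
  have smE: "smooth_on ?S E"
    unfolding E_def power2_eq_square by (intro smooth_on_mult opn sm)
  have smg: "smooth_on ?S (\<lambda>y. fundamental_tensor E y $ i $ j)" for i j
  proof -
    have "smooth_on ?S (\<lambda>y. (1/2) * dot_partial i (dot_partial j E) y)"
      by (intro smooth_on_mult opn smooth_on_dot_partial smE smooth_on_const)
    then show ?thesis by (simp add: fundamental_tensor_def)
  qed
  have "connected ?S"
    using n by (intro connected_punctured_universe) simp
  obtain e :: "real^'n" where e: "e \<in> ?S"
    using axis_eq_0_iff[of _ "1::real"] by (metis Compl_iff singletonD zero_neq_one)
  have const: "fundamental_tensor E y $ i $ j = fundamental_tensor E e $ i $ j" if "y \<in> ?S" for y i j
  proof -
    have "((\<lambda>y. fundamental_tensor E y $ i $ j) has_derivative (\<lambda>_. 0)) (at y)" if "y \<in> ?S" for y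
    proof -
      have "frechet_derivative (\<lambda>y. fundamental_tensor E y $ i $ j) (at y) = (\<lambda>_. 0)"
        using frechet_derivative_dot_partial[OF smooth_on_has_derivative[OF smg opn that, of i j]]
          cartan0[of y i j] that
        by (simp add: cartan_tensor_def E_def fun_eq_iff)
      then show ?thesis using smooth_on_has_derivative[OF smg opn that, of i j] by simp
    qed
    then show ?thesis
      by (rule has_derivative_zero_unique_connected[OF opn \<open>connected ?S\<close> _ that e])
  qed
  define G where "G = fundamental_tensor E e"
  have G: "fundamental_tensor E y = G" if "y \<noteq> 0" for y
    using const[of y] that by (simp add: G_def vec_eq_iff)
  have dd: "dot_partial i (dot_partial j E) y = 2 * G $ i $ j" if "y \<noteq> 0" for y i j
    using G[OF that] by (auto simp: fundamental_tensor_def vec_eq_iff)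
  \<comment> \<open>Euler's relation, differentiated twice along the ray through \<open>y\<close>\<close>
  have quad: "E y = y \<bullet> (G *v y)" for y
  proof (cases "y = 0")
    case True
    then show ?thesis using hom[of 0 0] by (simp add: E_def)
  next
    case y: False
    have homE: "E (r *\<^sub>R y) = r\<^sup>2 * E y" if "r > 0" for r
      using hom[of r y] that by (simp add: E_def power_mult_distrib)
    have ray: "((\<lambda>r. K (r *\<^sub>R y)) has_real_derivative (\<Sum>j\<in>UNIV. y $ j * dot_partial j K (r *\<^sub>R y))) (at r)"
      if "r > 0" "smooth_on ?S K" for r and K :: "real^'n \<Rightarrow> real"
    proof -
      have K: "(K has_derivative frechet_derivative K (at (r *\<^sub>R y))) (at (r *\<^sub>R y))"
        using that y by (intro smooth_on_has_derivative[OF that(2) opn]) auto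
      have "((\<lambda>r. K (r *\<^sub>R y)) has_derivative (\<lambda>d. frechet_derivative K (at (r *\<^sub>R y)) (d *\<^sub>R y))) (at r)"
        by (rule has_derivative_compose[of "\<lambda>r. r *\<^sub>R y", OF _ K]) (auto intro!: derivative_eq_intros)
      moreover have "frechet_derivative K (at (r *\<^sub>R y)) (d *\<^sub>R y)
          = (\<Sum>j\<in>UNIV. y $ j * dot_partial j K (r *\<^sub>R y)) * d" for d
        by (simp add: frechet_derivative_dot_partial[OF K] sum_distrib_left mult_ac)
      ultimately show ?thesis by (simp add: has_field_derivative_def)
    qed
    have first: "(\<Sum>j\<in>UNIV. y $ j * dot_partial j E (r *\<^sub>R y)) = 2 * r * E y" if "r > 0" for r
    proof (rule DERIV_unique[OF ray[OF that smE]])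
      have "((\<lambda>r. r\<^sup>2 * E y) has_real_derivative 2 * r * E y) (at r)"
        by (auto intro!: derivative_eq_intros)
      then show "((\<lambda>r. E (r *\<^sub>R y)) has_real_derivative 2 * r * E y) (at r)"
        by (rule has_field_derivative_transform_within_open[where S = "{0<..}"])
          (use that homE in auto)
    qed
    have "((\<lambda>r. \<Sum>j\<in>UNIV. y $ j * dot_partial j E (r *\<^sub>R y)) has_real_derivative
        (\<Sum>j\<in>UNIV. y $ j * (\<Sum>i\<in>UNIV. y $ i * dot_partial i (dot_partial j E) (1 *\<^sub>R y)))) (at 1)"
      by (intro DERIV_sum DERIV_cmult ray smooth_on_dot_partial smE) simp
    moreover have "((\<lambda>r. \<Sum>j\<in>UNIV. y $ j * dot_partial j E (r *\<^sub>R y)) has_real_derivative 2 * E y) (at 1)"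
    proof -
      have "((\<lambda>r. 2 * r * E y) has_real_derivative 2 * E y) (at 1)"
        by (auto intro!: derivative_eq_intros)
      then show ?thesis
        by (rule has_field_derivative_transform_within_open[where S = "{0<..}"])
          (use first in auto)
    qed
    ultimately have "2 * E y = (\<Sum>j\<in>UNIV. \<Sum>i\<in>UNIV. y $ j * y $ i * (2 * G $ i $ j))"
      using DERIV_unique y by (fastforce simp: dd sum_distrib_left mult_ac)
    also have "\<dots> = 2 * (y \<bullet> (G *v y))"
      unfolding inner_matrix_vector sum_distrib_left by (subst sum.swap) (simp add: mult_ac)
    finally show ?thesis by simp
  qed
  have "G $ i $ j = G $ j $ i" for i j
  proof -
    let ?y = "axis i 1 :: real^'n"
    have y: "?y \<noteq> 0" by (simp add: axis_eq_0_iff)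
    have "dot_partial j E z = z \<bullet> (G *v axis j 1) + axis j 1 \<bullet> (G *v z)" for z j
    proof (rule dot_partial_eqI)
      show "(E has_derivative (\<lambda>d. z \<bullet> (G *v d) + d \<bullet> (G *v z))) (at z)"
        unfolding quad by (auto intro!: derivative_eq_intros)
    qed
    moreover have "dot_partial i (\<lambda>z. z \<bullet> (G *v axis j 1) + axis j 1 \<bullet> (G *v z)) ?y
        = axis i 1 \<bullet> (G *v axis j 1) + axis j 1 \<bullet> (G *v axis i 1)"
      by (rule dot_partial_eqI) (auto intro!: derivative_eq_intros)
    ultimately have "dot_partial i (dot_partial j E) ?y = axis i 1 \<bullet> (G *v axis j 1) + axis j 1 \<bullet> (G *v axis i 1)"
      by presburger
    then have "2 * G $ i $ j = G $ i $ j + G $ j $ i"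
      using dd[OF y, of i j] by (simp add: inner_axis' matrix_vector_mul_component inner_axis)
    then show ?thesis by simp
  qed
  then have "transpose G = G" by (simp add: transpose_def vec_eq_iff)
  then show thesis using that G quad unfolding E_def by blast
qed

section \<open>A differential inequality on the interval of slopes\<close>

text \<open>With \<open>v x = w x - x * w1 x\<close>, the derivative of \<open>v\<^sup>2\<close> is \<open>- 2 x v w2\<close>, and by hypothesis
\<open>- (B\<^sup>2 - x\<^sup>2) v w2 \<ge> 3 v\<^sup>2\<close> inside the interval, whichever alternative holds at \<open>x\<close>. So \<open>v\<^sup>2\<close> increases
towards the end points, where by continuity the same inequality reads \<open>0 \<ge> 3 v\<^sup>2\<close>. The end points
are essential: \<open>K v + (B\<^sup>2 - x\<^sup>2) w2 = 0\<close> has solutions with \<open>v \<noteq> 0\<close> on every smaller interval.\<close>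

lemma ode_forces_quadratic:
  fixes h w w1 w2 :: "real \<Rightarrow> real"
  assumes B: "B > 0" and I: "open I" "{-B..B} \<subseteq> I"
    and h: "\<And>x. x \<in> I \<Longrightarrow> (h has_real_derivative 2 * w x) (at x)"
    and w: "\<And>x. x \<in> I \<Longrightarrow> (w has_real_derivative w1 x) (at x)"
    and w1: "\<And>x. x \<in> I \<Longrightarrow> (w1 has_real_derivative w2 x) (at x)"
    and cont: "continuous_on I w2"
    and ode: "\<And>x. -B < x \<Longrightarrow> x < B \<Longrightarrow>
      w x - x * w1 x = 0 \<or> (\<exists>K\<ge>3. K * (w x - x * w1 x) + (B\<^sup>2 - x\<^sup>2) * w2 x = 0)"
  shows "x \<in> {-B..B} \<Longrightarrow> w x - x * w1 x = 0"
    and "x \<in> {-B..B} \<Longrightarrow> w2 x = 0"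
    and "x \<in> {-B..B} \<Longrightarrow> w x = w1 0 * x"
    and "x \<in> {-B..B} \<Longrightarrow> h x = h 0 + w1 0 * x\<^sup>2"
proof -
  define v where "v = (\<lambda>x. w x - x * w1 x)"
  have v: "(v has_real_derivative - (x * w2 x)) (at x)" if "x \<in> I" for x
    unfolding v_def by (rule derivative_eq_intros w[OF that] w1[OF that] refl)+ simp
  have contv: "continuous_on I v"
    using v by (intro continuous_at_imp_continuous_on) (blast intro: DERIV_isCont)
  define g where "g = (\<lambda>x. - (B\<^sup>2 - x\<^sup>2) * v x * w2 x)"
  have g: "g x \<ge> 3 * (v x)\<^sup>2" if x: "x \<in> {-B<..<B}" for x
  proof -
    have "v x = 0 \<or> (\<exists>K\<ge>3. K * v x + (B\<^sup>2 - x\<^sup>2) * w2 x = 0)"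
      using ode[of x] x by (simp add: v_def)
    then show ?thesis
    proof
      assume "\<exists>K\<ge>3. K * v x + (B\<^sup>2 - x\<^sup>2) * w2 x = 0"
      then obtain K where K: "K \<ge> 3" "(B\<^sup>2 - x\<^sup>2) * w2 x = - (K * v x)" by (metis add_eq_0_iff)
      have "g x = - (v x * ((B\<^sup>2 - x\<^sup>2) * w2 x))" by (simp add: g_def algebra_simps)
      also have "\<dots> = K * (v x)\<^sup>2" unfolding K(2) by (simp add: power2_eq_square)
      finally show ?thesis using K(1) by (simp add: mult_right_mono)
    qed (simp add: g_def)
  qed
  have contg: "continuous_on I g"
    unfolding g_def by (intro continuous_intros contv cont)
  have gB: "g x \<ge> 3 * (v x)\<^sup>2" if "x \<in> {-B..B}" for x
  proof -
    have cl: "closure {-B<..<B} = {-B..B}" using B by (intro closure_greaterThanLessThan) simp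
    have "continuous_on {-B..B} (\<lambda>x. g x - 3 * (v x)\<^sup>2)"
      by (intro continuous_intros continuous_on_subset[OF contg I(2)] continuous_on_subset[OF contv I(2)])
    then have "g x - 3 * (v x)\<^sup>2 \<ge> 0"
      using continuous_ge_on_closure[of "{-B<..<B}" "\<lambda>x. g x - 3 * (v x)\<^sup>2" x 0] g that
      unfolding cl by force
    then show ?thesis by simp
  qed
  have vB: "v B = 0" "v (-B) = 0"
    using gB[of B] gB[of "-B"] B by (auto simp: g_def)
  have der2: "((\<lambda>x. (v x)\<^sup>2) has_real_derivative - (2 * x * v x * w2 x)) (at x)" if "x \<in> I" for x
    by (rule derivative_eq_intros v[OF that] refl)+ simp
  have pos: "- (v x * w2 x) \<ge> 0" if "x \<in> {-B<..<B}" for x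
  proof -
    have "x\<^sup>2 < B\<^sup>2" using that by (intro power2_strict_mono) auto
    moreover have "(B\<^sup>2 - x\<^sup>2) * (- (v x * w2 x)) \<ge> 0"
      using order_trans[OF _ g[OF that], of 0] by (simp add: g_def algebra_simps)
    ultimately show ?thesis by (simp only: zero_le_mult_iff) auto
  qed
  have v0: "v x = 0" if "x \<in> {-B..B}" for x
  proof (cases "x \<ge> 0")
    case True
    have "(v x)\<^sup>2 \<le> (v B)\<^sup>2"
    proof (rule DERIV_nonneg_imp_increasing_open[where f = "\<lambda>x. (v x)\<^sup>2"])
      show "continuous_on {x..B} (\<lambda>x. (v x)\<^sup>2)"
        using I(2) that by (intro continuous_intros continuous_on_subset[OF contv]) auto
      fix z assume z: "x < z" "z < B"
      with that True I(2) have "z \<in> I" by auto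
      with z show "\<exists>y. ((\<lambda>x. (v x)\<^sup>2) has_real_derivative y) (at z) \<and> 0 \<le> y"
        using der2[of z] pos[of z] True I(2) mult_nonneg_nonneg[of "2*z" "- (v z * w2 z)"]
        by (intro exI[of _ "- (2 * z * v z * w2 z)"]) (auto simp: mult_ac)
    qed (use that in auto)
    then show ?thesis by (simp add: vB)
  next
    case False
    have "(v x)\<^sup>2 \<le> (v (-B))\<^sup>2"
    proof (rule DERIV_nonpos_imp_decreasing_open[where f = "\<lambda>x. (v x)\<^sup>2"])
      show "continuous_on {-B..x} (\<lambda>x. (v x)\<^sup>2)"
        using I(2) that by (intro continuous_intros continuous_on_subset[OF contv]) auto
      fix z assume z: "-B < z" "z < x"
      with that False I(2) have "z \<in> I" by auto
      with z show "\<exists>y. ((\<lambda>x. (v x)\<^sup>2) has_real_derivative y) (at z) \<and> y \<le> 0"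
        using der2[of z] pos[of z] False I(2) that mult_nonneg_nonneg[of "-2*z" "- (v z * w2 z)"]
        by (intro exI[of _ "- (2 * z * v z * w2 z)"]) (auto simp: mult_ac)
    qed (use that in auto)
    then show ?thesis by (simp add: vB)
  qed
  then show vx: "w x - x * w1 x = 0" if "x \<in> {-B..B}" for x
    using that by (simp add: v_def)
  have w20: "w2 x = 0" if x: "x \<in> {-B<..<B}" "x \<noteq> 0" for x
  proof -
    have "((\<lambda>_. 0) has_real_derivative - (x * w2 x)) (at x)"
      by (rule has_field_derivative_transform_within_open[OF v, where S = "{-B<..<B}"])
        (use v0 x I(2) in auto)
    then show ?thesis using DERIV_unique[OF _ DERIV_const] x by fastforce
  qed
  show w2z: "w2 x = 0" if "x \<in> {-B..B}" for x
  proof -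
    have cl: "closure {0<..<B} = {0..B}" "closure {-B<..<0} = {-B..0}" using B by simp_all
    show ?thesis
    proof (cases "x \<ge> 0")
      case True
      then show ?thesis
        using continuous_constant_on_closure[of "{0<..<B}" w2 0 x] w20 that I(2)
          continuous_on_subset[OF cont, of "{0..B}"] B unfolding cl by (simp add: subset_iff)
    next
      case False
      then show ?thesis
        using continuous_constant_on_closure[of "{-B<..<0}" w2 0 x] w20 that I(2)
          continuous_on_subset[OF cont, of "{-B..0}"] B unfolding cl by (simp add: subset_iff)
    qed
  qed
  have w1c: "w1 x = w1 0" if "x \<in> {-B..B}" for x
  proof -
    have "(w1 has_field_derivative 0) (at z within {-B..B})" if "z \<in> {-B..B}" for z
      using w1[of z] w2z[OF that] I(2) that has_field_derivative_at_within by fastforce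
    then obtain c where "\<forall>z\<in>{-B..B}. w1 z = c"
      using has_field_derivative_zero_constant[of "{-B..B}" w1] by auto
    then show ?thesis using that B by simp
  qed
  show wx: "w x = w1 0 * x" if "x \<in> {-B..B}" for x
    using vx[OF that] w1c[OF that] by simp
  show "h x = h 0 + w1 0 * x\<^sup>2" if "x \<in> {-B..B}" for x
  proof -
    have "((\<lambda>z. h z - w1 0 * z\<^sup>2) has_field_derivative 0) (at z within {-B..B})" if "z \<in> {-B..B}" for z
    proof -
      have "((\<lambda>z. h z - w1 0 * z\<^sup>2) has_real_derivative 2 * w z - w1 0 * (2 * z)) (at z)"
        by (rule DERIV_diff[OF h]) (use that I(2) in \<open>auto intro!: derivative_eq_intros\<close>)
      then show ?thesis using wx[OF that] has_field_derivative_at_within by fastforce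
    qed
    then obtain c where c: "\<forall>z\<in>{-B..B}. h z - w1 0 * z\<^sup>2 = c"
      using has_field_derivative_zero_constant[of "{-B..B}" "\<lambda>z. h z - w1 0 * z\<^sup>2"] by auto
    then show ?thesis using bspec[OF c that] bspec[OF c, of 0] B by simp
  qed
qed

section \<open>Tensors of a metric depending on a norm and a linear form\<close>

text \<open>One fibre of the transformed space: \<open>G\<close> is the quadratic form of \<open>e\<^sup>\<sigma> L\<close>, \<open>b\<close> the 1-form and \<open>bs\<close>
the vector obtained from it by raising its index with \<open>G\<close>. The functions \<open>w\<close>, \<open>w1\<close>, \<open>w2\<close> are half the
first three derivatives of the profile \<open>h\<close>, on a set \<open>I\<close> that contains all values of the slope
\<open>\<tau> = \<beta> / (e\<^sup>\<sigma> L)\<close>.\<close>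

locale beta_fibre =
  fixes G :: "real^'n::finite^'n" and b bs :: "real^'n" and I :: "real set"
    and h w w1 w2 :: "real \<Rightarrow> real"
  assumes G_sym: "transpose G = G"
    and G_pos: "\<And>z. z \<noteq> 0 \<Longrightarrow> z \<bullet> (G *v z) > 0"
    and G_bs: "G *v bs = b"
    and ratio_in_I: "\<And>y. y \<noteq> 0 \<Longrightarrow> b \<bullet> y / sqrt (y \<bullet> (G *v y)) \<in> I"
    and h: "\<And>x. x \<in> I \<Longrightarrow> (h has_real_derivative 2 * w x) (at x)"
    and w: "\<And>x. x \<in> I \<Longrightarrow> (w has_real_derivative w1 x) (at x)"
    and w1: "\<And>x. x \<in> I \<Longrightarrow> (w1 has_real_derivative w2 x) (at x)"
begin

definition s :: "real^'n \<Rightarrow> real" where "s y = sqrt (y \<bullet> (G *v y))"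
definition \<tau> :: "real^'n \<Rightarrow> real" where "\<tau> y = b \<bullet> y / s y"
definition m :: "real^'n \<Rightarrow> real^'n" where "m y = b - (\<tau> y / s y) *\<^sub>R (G *v y)"
text \<open>The covector \<open>m\<close> with its index raised by \<open>G\<close>.\<close>

definition ms :: "real^'n \<Rightarrow> real^'n" where "ms y = bs - (\<tau> y / s y) *\<^sub>R y"
definition E :: "real^'n \<Rightarrow> real" where "E y = (s y)\<^sup>2 * h (\<tau> y)"
text \<open>The coefficient of \<open>G\<close> in the fundamental tensor, and its derivative \<open>v\<close>, which is the coefficient
of the angular metric in the Cartan tensor. It vanishes at \<open>x\<close> exactly when \<open>h\<close> agrees there to
second order with a polynomial \<open>a + c x\<^sup>2\<close>, the profile of an energy change.\<close>

definition u :: "real \<Rightarrow> real" where "u x = h x - x * w x"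
definition v :: "real \<Rightarrow> real" where "v x = w x - x * w1 x"
text \<open>The angular metric of \<open>G\<close>: the orthogonal projection along \<open>y\<close>, lowered.\<close>

definition H :: "real^'n \<Rightarrow> 'n \<Rightarrow> 'n \<Rightarrow> real" where
  "H y i j = G $ i $ j - (G *v y) $ i * (G *v y) $ j / (s y)\<^sup>2"

lemma s_pos: "y \<noteq> 0 \<Longrightarrow> s y > 0"
  by (simp add: s_def G_pos)

lemma s_sq: "(s y)\<^sup>2 = y \<bullet> (G *v y)"
  using G_pos[of y] by (cases "y = 0") (auto simp: s_def)

lemma G_commute: "x \<bullet> (G *v y) = y \<bullet> (G *v x)"
  by (rule inner_matrix_vector_commute[OF G_sym])

lemma G_entry_sym: "G $ i $ j = G $ j $ i"
  using G_sym by (simp add: transpose_def vec_eq_iff)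

lemma b_nth: "b $ j = m y $ j + \<tau> y / s y * (G *v y) $ j"
  by (simp add: m_def)

lemma b_inner: "y \<noteq> 0 \<Longrightarrow> b \<bullet> y = \<tau> y * s y"
  using s_pos[of y] by (simp add: \<tau>_def)

lemma m_inner_self: "y \<noteq> 0 \<Longrightarrow> m y \<bullet> y = 0"
  using s_pos[of y] b_inner[of y]
  by (simp add: m_def inner_diff_left inner_commute[of "G *v y"] power2_eq_square flip: s_sq)

lemma G_ms: "G *v ms y = m y"
  by (simp add: ms_def m_def G_bs matrix_vector_mult_diff_distrib matrix_vector_mult_scaleR)

text \<open>This is the identity \<open>m\<^sup>2 = B\<^sup>2 - \<tau>\<^sup>2\<close>, by which the coefficient of the differential equation depends
on \<open>y\<close> through \<open>\<tau>\<close> only.\<close>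

lemma m_inner_ms:
  assumes "y \<noteq> 0" shows "m y \<bullet> ms y = b \<bullet> bs - (\<tau> y)\<^sup>2"
proof -
  have "m y \<bullet> ms y = m y \<bullet> bs - (\<tau> y / s y) * (m y \<bullet> y)"
    by (simp add: ms_def inner_diff_right)
  also have "\<dots> = m y \<bullet> bs" by (simp add: m_inner_self[OF assms])
  also have "\<dots> = b \<bullet> bs - (\<tau> y / s y) * (bs \<bullet> (G *v y))"
    by (simp add: m_def inner_diff_right inner_commute[of _ bs])
  also have "bs \<bullet> (G *v y) = \<tau> y * s y"
    using G_commute[of bs y] b_inner[OF assms] by (simp add: G_bs inner_commute)
  finally show ?thesis using s_pos[OF assms] by (simp add: power2_eq_square)
qed

lemma \<tau>_in_I: "y \<noteq> 0 \<Longrightarrow> \<tau> y \<in> I"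
  using ratio_in_I by (simp add: \<tau>_def s_def)

lemma has_derivative_s:
  assumes "y \<noteq> 0"
  shows "(s has_derivative (\<lambda>d. (G *v y) \<bullet> d / s y)) (at y)"
proof -
  have "((\<lambda>y. y \<bullet> (G *v y)) has_derivative (\<lambda>d. 2 * ((G *v y) \<bullet> d))) (at y)"
    by (rule has_derivative_eq_rhs[OF has_derivative_inner[OF has_derivative_ident has_derivative_matrix_vector]])
      (simp add: fun_eq_iff G_commute[of y] inner_commute)
  from has_derivative_real_sqrt[OF _ this] G_pos[OF assms] show ?thesis
    unfolding s_def by (simp add: field_simps)
qed

lemma has_derivative_\<tau>:
  assumes "y \<noteq> 0"
  shows "(\<tau> has_derivative (\<lambda>d. m y \<bullet> d / s y)) (at y)"
proof -
  have "((\<lambda>y. b \<bullet> y / s y) has_derivative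
      (\<lambda>d. - (b \<bullet> y) * (inverse (s y) * ((G *v y) \<bullet> d / s y) * inverse (s y)) + b \<bullet> d / s y)) (at y)"
    using s_pos[OF assms]
    by (intro has_derivative_divide has_derivative_s assms has_derivative_inner_right has_derivative_ident) simp
  then show ?thesis
    unfolding \<tau>_def[abs_def]
    by (rule has_derivative_eq_rhs)
      (use s_pos[OF assms] in \<open>simp add: fun_eq_iff m_def \<tau>_def inner_diff_left field_simps\<close>)
qed

lemma has_derivative_comp_\<tau>:
  assumes "y \<noteq> 0" "\<And>x. x \<in> I \<Longrightarrow> (k has_real_derivative k' x) (at x)"
  shows "((\<lambda>y. k (\<tau> y)) has_derivative (\<lambda>d. k' (\<tau> y) * (m y \<bullet> d / s y))) (at y)"
  using has_derivative_compose[OF has_derivative_\<tau>[OF assms(1)]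
      assms(2)[OF \<tau>_in_I[OF assms(1)], unfolded has_field_derivative_def]] .

lemma u_deriv: "x \<in> I \<Longrightarrow> (u has_real_derivative v x) (at x)"
  unfolding u_def[abs_def] v_def by (rule derivative_eq_intros h w refl | assumption)+ simp

lemma has_derivative_m:
  assumes "y \<noteq> 0"
  shows "((\<lambda>y. m y $ i) has_derivative
    (\<lambda>d. - (m y \<bullet> d) * (G *v y) $ i / (s y)\<^sup>2 + \<tau> y * ((G *v y) \<bullet> d) * (G *v y) $ i / (s y) ^ 3
      - \<tau> y / s y * (G *v d) $ i)) (at y)"
proof -
  have "((\<lambda>y. b $ i - \<tau> y * (G *v y) $ i / s y) has_derivative
    (\<lambda>d. - (m y \<bullet> d) * (G *v y) $ i / (s y)\<^sup>2 + \<tau> y * ((G *v y) \<bullet> d) * (G *v y) $ i / (s y) ^ 3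
      - \<tau> y / s y * (G *v d) $ i)) (at y)"
    by (rule has_derivative_eq_rhs[OF has_derivative_diff[OF has_derivative_const has_derivative_divide
          [OF has_derivative_mult[OF has_derivative_\<tau> has_derivative_matrix_vector_nth] has_derivative_s]]])
      (use assms s_pos[OF assms] in \<open>auto simp: fun_eq_iff field_simps power2_eq_square power3_eq_cube\<close>)
  then show ?thesis by (simp add: m_def)
qed

lemma dot_partial_E:
  assumes "y \<noteq> 0"
  shows "dot_partial j E y = 2 * (u (\<tau> y) * (G *v y) $ j + s y * w (\<tau> y) * b $ j)"
proof -
  have "(E has_derivative (\<lambda>d. (s y)\<^sup>2 * (2 * w (\<tau> y) * (m y \<bullet> d / s y)) + 2 * s y * ((G *v y) \<bullet> d / s y) * h (\<tau> y))) (at y)"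
    unfolding E_def[abs_def] power2_eq_square
    by (rule has_derivative_eq_rhs[OF has_derivative_mult[OF has_derivative_mult[OF has_derivative_s has_derivative_s] has_derivative_comp_\<tau>[OF assms h]]])
      (use assms in \<open>auto simp: fun_eq_iff algebra_simps\<close>)
  then have "dot_partial j E y = (s y)\<^sup>2 * (2 * w (\<tau> y) * (m y $ j / s y)) + 2 * s y * ((G *v y) $ j / s y) * h (\<tau> y)"
    by (simp add: dot_partial_eqI inner_axis)
  then show ?thesis
    using s_pos[OF assms] by (simp add: u_def b_nth[of _ y] field_simps power2_eq_square)
qed

text \<open>In the frame of \<open>m\<close> and the lowered \<open>y\<close> (rather than \<open>b\<close> and \<open>y\<close>) all coefficients are powers of
\<open>1 / s\<close> times functions of \<open>\<tau>\<close>, which keeps the next differentiation polynomial.\<close>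

lemma fundamental_tensor_E:
  assumes "y \<noteq> 0"
  shows "fundamental_tensor E y $ i $ j = u (\<tau> y) * G $ i $ j
    + w (\<tau> y) / s y * (m y $ i * (G *v y) $ j + (G *v y) $ i * m y $ j)
    + \<tau> y * w (\<tau> y) / (s y)\<^sup>2 * ((G *v y) $ i * (G *v y) $ j)
    + w1 (\<tau> y) * (m y $ i * m y $ j)"
proof -
  have der: "((\<lambda>y. 2 * (u (\<tau> y) * (G *v y) $ j + s y * w (\<tau> y) * b $ j)) has_derivative
     (\<lambda>d. 2 * ((u (\<tau> y) * (G *v d) $ j + v (\<tau> y) * (m y \<bullet> d / s y) * (G *v y) $ j)
        + (s y * (w1 (\<tau> y) * (m y \<bullet> d / s y)) + (G *v y) \<bullet> d / s y * w (\<tau> y)) * b $ j))) (at y)"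
    by (intro has_derivative_mult_right has_derivative_add has_derivative_mult has_derivative_mult_left
        has_derivative_matrix_vector_nth has_derivative_s has_derivative_comp_\<tau> u_deriv w assms)
  have "dot_partial i (dot_partial j E) y
      = dot_partial i (\<lambda>y. 2 * (u (\<tau> y) * (G *v y) $ j + s y * w (\<tau> y) * b $ j)) y"
    by (rule dot_partial_cong[of "-{0}"]) (use assms dot_partial_E in auto)
  also note dot_partial_eqI[OF der]
  finally have dd: "dot_partial i (dot_partial j E) y
      = 2 * ((u (\<tau> y) * G $ j $ i + v (\<tau> y) * (m y $ i / s y) * (G *v y) $ j)
        + (s y * (w1 (\<tau> y) * (m y $ i / s y)) + (G *v y) $ i / s y * w (\<tau> y)) * b $ j)"
    by (simp only: matrix_vector_axis_nth inner_axis inner_real_def mult_1_right)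
  have F: "fundamental_tensor E y $ i $ j = 1/2 * dot_partial i (dot_partial j E) y"
    by (simp add: fundamental_tensor_def)
  show ?thesis
    unfolding F dd using s_pos[OF assms]
    by (simp add: v_def b_nth[of _ y] G_entry_sym[of j i] field_simps power2_eq_square)
qed

text \<open>Each derivative of a function of \<open>\<tau>\<close> produces the factor \<open>m\<^sub>k / s\<close>. The terms along the lowered
\<open>y\<close> that arise from differentiating \<open>m\<close> and \<open>s\<close> are exactly those that complete \<open>G\<close> to the angular
metric, as they must because \<open>C\<^sub>i\<^sub>j\<^sub>k y\<^sup>k = 0\<close>.\<close>

lemma cartan_tensor_E:
  assumes "y \<noteq> 0"
  shows "cartan_tensor E y i j k =
    (v (\<tau> y) * (H y i j * m y $ k + H y i k * m y $ j + H y j k * m y $ i)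
      + w2 (\<tau> y) * (m y $ i * m y $ j * m y $ k)) / (2 * s y)"
proof -
  define Y where "Y = G *v y"
  have s: "s y \<noteq> 0" using s_pos[OF assms] by simp
  let ?g = "\<lambda>y. u (\<tau> y) * G $ i $ j
    + w (\<tau> y) / s y * (m y $ i * (G *v y) $ j + (G *v y) $ i * m y $ j)
    + \<tau> y * w (\<tau> y) / (s y)\<^sup>2 * ((G *v y) $ i * (G *v y) $ j)
    + w1 (\<tau> y) * (m y $ i * m y $ j)"
  note d = has_derivative_m[OF assms] has_derivative_matrix_vector_nth
  have 1: "((\<lambda>y. w (\<tau> y) / s y) has_derivative
      (\<lambda>d. w1 (\<tau> y) * (m y \<bullet> d) / (s y)\<^sup>2 - w (\<tau> y) * (Y \<bullet> d) / s y ^ 3)) (at y)"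
    by (rule has_derivative_eq_rhs[OF has_derivative_divide[OF has_derivative_comp_\<tau>[OF assms w]
          has_derivative_s[OF assms]]])
      (use s in \<open>auto simp: Y_def fun_eq_iff field_simps power2_eq_square power3_eq_cube\<close>)
  have 2: "((\<lambda>y. \<tau> y * w (\<tau> y) / (s y)\<^sup>2) has_derivative
      (\<lambda>d. (w (\<tau> y) + \<tau> y * w1 (\<tau> y)) * (m y \<bullet> d) / s y ^ 3
        - 2 * \<tau> y * w (\<tau> y) * (Y \<bullet> d) / s y ^ 4)) (at y)"
    unfolding power2_eq_square[of "s _"]
    by (rule has_derivative_eq_rhs[OF has_derivative_divide[OF
          has_derivative_mult[OF has_derivative_\<tau>[OF assms] has_derivative_comp_\<tau>[OF assms w]]
          has_derivative_mult[OF has_derivative_s[OF assms] has_derivative_s[OF assms]]]])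
      (use s in \<open>auto simp: Y_def fun_eq_iff field_simps power3_eq_cube power4_eq_xxxx\<close>)
  have der: "(?g has_derivative (\<lambda>d. v (\<tau> y) * (m y \<bullet> d / s y) * G $ i $ j
     + (w (\<tau> y) / s y * ((m y $ i * (G *v d) $ j + (- (m y \<bullet> d) * Y $ i / (s y)\<^sup>2 + \<tau> y * (Y \<bullet> d) * Y $ i / (s y) ^ 3
      - \<tau> y / s y * (G *v d) $ i) * Y $ j) + (Y $ i * (- (m y \<bullet> d) * Y $ j / (s y)\<^sup>2 + \<tau> y * (Y \<bullet> d) * Y $ j / (s y) ^ 3
      - \<tau> y / s y * (G *v d) $ j) + (G *v d) $ i * m y $ j))
      + (w1 (\<tau> y) * (m y \<bullet> d) / (s y)\<^sup>2 - w (\<tau> y) * (Y \<bullet> d) / s y ^ 3) * (m y $ i * Y $ j + Y $ i * m y $ j))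
     + (\<tau> y * w (\<tau> y) / (s y)\<^sup>2 * (Y $ i * (G *v d) $ j + (G *v d) $ i * Y $ j)
       + ((w (\<tau> y) + \<tau> y * w1 (\<tau> y)) * (m y \<bullet> d) / s y ^ 3
        - 2 * \<tau> y * w (\<tau> y) * (Y \<bullet> d) / s y ^ 4) * (Y $ i * Y $ j))
     + (w1 (\<tau> y) * (m y $ i * (- (m y \<bullet> d) * Y $ j / (s y)\<^sup>2 + \<tau> y * (Y \<bullet> d) * Y $ j / (s y) ^ 3
      - \<tau> y / s y * (G *v d) $ j) + (- (m y \<bullet> d) * Y $ i / (s y)\<^sup>2 + \<tau> y * (Y \<bullet> d) * Y $ i / (s y) ^ 3
      - \<tau> y / s y * (G *v d) $ i) * m y $ j)
       + w2 (\<tau> y) * (m y \<bullet> d / s y) * (m y $ i * m y $ j)))) (at y)"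
    unfolding Y_def
    by (intro has_derivative_add has_derivative_mult has_derivative_mult_left d
        1[unfolded Y_def] 2[unfolded Y_def] has_derivative_comp_\<tau> assms u_deriv w1)
  have "dot_partial k (\<lambda>z. fundamental_tensor E z $ i $ j) y = dot_partial k ?g y"
    by (rule dot_partial_cong[of "-{0}"]) (use assms fundamental_tensor_E in auto)
  also note dot_partial_eqI[OF der]
  finally have "cartan_tensor E y i j k = 1/2 * (v (\<tau> y) * (m y $ k / s y) * G $ i $ j
     + (w (\<tau> y) / s y * ((m y $ i * G $ j $ k + (- (m y $ k) * Y $ i / (s y)\<^sup>2 + \<tau> y * (Y $ k) * Y $ i / (s y) ^ 3
      - \<tau> y / s y * G $ i $ k) * Y $ j) + (Y $ i * (- (m y $ k) * Y $ j / (s y)\<^sup>2 + \<tau> y * (Y $ k) * Y $ j / (s y) ^ 3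
      - \<tau> y / s y * G $ j $ k) + G $ i $ k * m y $ j))
      + (w1 (\<tau> y) * (m y $ k) / (s y)\<^sup>2 - w (\<tau> y) * (Y $ k) / s y ^ 3) * (m y $ i * Y $ j + Y $ i * m y $ j))
     + (\<tau> y * w (\<tau> y) / (s y)\<^sup>2 * (Y $ i * G $ j $ k + G $ i $ k * Y $ j)
       + ((w (\<tau> y) + \<tau> y * w1 (\<tau> y)) * (m y $ k) / s y ^ 3
        - 2 * \<tau> y * w (\<tau> y) * (Y $ k) / s y ^ 4) * (Y $ i * Y $ j))
     + (w1 (\<tau> y) * (m y $ i * (- (m y $ k) * Y $ j / (s y)\<^sup>2 + \<tau> y * (Y $ k) * Y $ j / (s y) ^ 3
      - \<tau> y / s y * G $ j $ k) + (- (m y $ k) * Y $ i / (s y)\<^sup>2 + \<tau> y * (Y $ k) * Y $ i / (s y) ^ 3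
      - \<tau> y / s y * G $ i $ k) * m y $ j)
       + w2 (\<tau> y) * (m y $ k / s y) * (m y $ i * m y $ j)))"
    unfolding cartan_tensor_def by (simp only: matrix_vector_axis_nth inner_axis inner_real_def mult_1_right)
  \<comment> \<open>The identity is polynomial in \<open>1 / s\<close>, so no case distinction on \<open>s\<close> is needed.\<close>
  moreover define r where "r = inverse (s y)"
  ultimately show ?thesis
    unfolding H_def v_def Y_def[symmetric] divide_inverse inverse_mult_distrib
      power_inverse[symmetric] r_def[symmetric]
    by (simp add: algebra_simps power2_eq_square power3_eq_cube power4_eq_xxxx)
qed

end

section \<open>The C2-like condition on one fibre\<close>

context beta_fibre begin

text \<open>Contraction with a vector \<open>z\<close> orthogonal to \<open>y\<close> and \<open>m\<close> leaves the alternative \<open>v = 0\<close> or \<open>c = 0\<close>.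
In the latter case the trace is computed by writing \<open>u H\<close> as \<open>g\<close> minus rank one terms in the lowered
\<open>y\<close> and in \<open>m\<close>: the inverse of \<open>g\<close> sends these two covectors to explicit vectors, so that no
inverse matrix has to be computed.\<close>

lemma C2_like_ode:
  fixes y :: "real^'n"
  defines "g \<equiv> fundamental_tensor E y" and "C \<equiv> cartan_tensor E y"
  defines "c \<equiv> \<lambda>i. \<Sum>j\<in>UNIV. \<Sum>k\<in>UNIV. C i j k * matrix_inv g $ j $ k"
  defines "N \<equiv> \<Sum>i\<in>UNIV. \<Sum>j\<in>UNIV. matrix_inv g $ i $ j * c i * c j"
  assumes n: "CARD('n) \<ge> 3" and y: "y \<noteq> 0" and m2: "(\<tau> y)\<^sup>2 < b \<bullet> bs"
    and g_pos: "\<And>z. z \<noteq> 0 \<Longrightarrow> z \<bullet> (g *v z) > 0"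
    and C2: "\<And>i j k. N * C i j k = c i * c j * c k"
  shows "v (\<tau> y) = 0 \<or> (\<exists>K\<ge>3. K * v (\<tau> y) + (b \<bullet> bs - (\<tau> y)\<^sup>2) * w2 (\<tau> y) = 0)"
proof -
  define t S Y M M' where "t = \<tau> y" and "S = s y" and "Y = G *v y" and "M = m y" and "M' = ms y"
  define m2 where "m2 = b \<bullet> bs - t\<^sup>2"
  have S: "S > 0" using s_pos[OF y] by (simp add: S_def)
  have m2_pos: "m2 > 0" using m2 by (simp add: m2_def t_def)
  have MM': "M \<bullet> M' = m2" by (simp add: M_def M'_def m2_def t_def m_inner_ms[OF y])
  have GM': "G *v M' = M" by (simp add: M_def M'_def G_ms)
  have My: "M \<bullet> y = 0" using m_inner_self[OF y] by (simp add: M_def)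
  have Yy: "Y \<bullet> y = S\<^sup>2" by (simp add: Y_def S_def s_sq inner_commute)
  have YM': "Y \<bullet> M' = 0"
    using My G_commute[of M' y] by (simp add: Y_def GM' inner_commute)
  have g: "g $ i $ j = u t * G $ i $ j + w t / S * (M $ i * Y $ j + Y $ i * M $ j)
      + t * w t / S\<^sup>2 * (Y $ i * Y $ j) + w1 t * (M $ i * M $ j)" for i j
    unfolding g_def t_def S_def Y_def M_def by (rule fundamental_tensor_E[OF y])
  have C: "C i j k = (v t * (H y i j * M $ k + H y i k * M $ j + H y j k * M $ i)
      + w2 t * (M $ i * M $ j * M $ k)) / (2 * S)" for i j k
    unfolding C_def t_def S_def M_def by (rule cartan_tensor_E[OF y])
  have H: "H y j k = G $ j $ k - Y $ j * Y $ k / S\<^sup>2" for j k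
    by (simp add: H_def Y_def S_def)
  have H_apply: "(\<Sum>k\<in>UNIV. H y j k * x $ k) = (G *v x) $ j - (Y \<bullet> x) * Y $ j / S\<^sup>2" for j x
    unfolding H matrix_vector_mult_def inner_vec_def left_diff_distrib sum_subtractf
    by (simp add: sum_distrib_left sum_divide_distrib mult_ac)
  have H_sym: "H y j k = H y k j" for j k by (simp add: H G_entry_sym[of j k])
  have g_apply: "g *v x = u t *\<^sub>R (G *v x) + (w t / S * (Y \<bullet> x) + w1 t * (M \<bullet> x)) *\<^sub>R M
      + (w t / S * (M \<bullet> x) + t * w t / S\<^sup>2 * (Y \<bullet> x)) *\<^sub>R Y" for x
  proof -
    have "(g *v x) $ i = u t * (\<Sum>j\<in>UNIV. G $ i $ j * x $ j)
       + w t / S * (M $ i * (\<Sum>j\<in>UNIV. Y $ j * x $ j) + Y $ i * (\<Sum>j\<in>UNIV. M $ j * x $ j))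
       + t * w t / S\<^sup>2 * (Y $ i * (\<Sum>j\<in>UNIV. Y $ j * x $ j))
       + w1 t * (M $ i * (\<Sum>j\<in>UNIV. M $ j * x $ j))" for i
      unfolding matrix_vector_mult_def sum_distrib_left sum.distrib[symmetric]
      by (simp add: g algebra_simps)
    then show ?thesis
      by (simp add: vec_eq_iff matrix_vector_mult_def inner_vec_def algebra_simps)
  qed
  have g_sym: "transpose g = g"
    by (simp add: transpose_def vec_eq_iff g G_entry_sym mult_ac)
  have g_inv: "invertible g" by (rule positive_definite_invertible[OF g_pos])
  note inv_apply = matrix_inv_apply[OF g_inv]
  \<comment> \<open>\<open>l\<close> is \<open>y\<close> lowered by \<open>g\<close>\<close>
  define l where "l = g *v y"
  have l: "l = h t *\<^sub>R Y + (S * w t) *\<^sub>R M"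
    unfolding l_def g_apply Y_def[symmetric] using S
    by (simp add: Yy My u_def power2_eq_square algebra_simps)
  have ly: "l \<bullet> y = h t * S\<^sup>2" by (simp add: l inner_add_left Yy My)
  have h_pos: "h t > 0"
    using g_pos[OF y] ly S by (simp add: l_def inner_commute zero_less_mult_iff)
  \<comment> \<open>\<open>e\<close> is \<open>M'\<close> made \<open>g\<close>-orthogonal to \<open>y\<close>; up to the factor \<open>D\<close> it is \<open>m\<close> raised by \<open>g\<close>.\<close>
  define D where "D = u t + (w1 t - (w t)\<^sup>2 / h t) * m2"
  define e where "e = M' - (w t * m2 / (S * h t)) *\<^sub>R y"
  have ge: "g *v e = D *\<^sub>R M"
  proof -
    have "g *v M' = (u t + w1 t * m2) *\<^sub>R M + (w t / S * m2) *\<^sub>R Y"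
      unfolding g_apply by (simp add: GM' YM' MM' algebra_simps)
    moreover have "g *v e = g *v M' - (w t * m2 / (S * h t)) *\<^sub>R l"
      by (simp add: e_def l_def matrix_vector_mult_diff_distrib matrix_vector_mult_scaleR)
    ultimately show ?thesis
      using S h_pos by (simp add: l D_def power2_eq_square algebra_simps)
  qed
  have Me: "M \<bullet> e = m2" by (simp add: e_def inner_diff_right MM' My)
  then have "e \<noteq> 0" using m2_pos by auto
  then have D_pos: "D > 0"
    using g_pos[of e] m2_pos by (simp add: ge inner_commute[of e] Me zero_less_mult_iff)
  obtain z where z: "z \<noteq> 0" "Y \<bullet> z = 0" "M \<bullet> z = 0"
    using exists_orthogonal_to_pair[OF n] by blast
  have zGz: "z \<bullet> (G *v z) > 0" using G_pos[OF z(1)] .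
  have u_pos: "u t > 0"
    using g_pos[OF z(1)] zGz by (simp add: g_apply z inner_add_right inner_commute[of z] zero_less_mult_iff)
  have sumM: "(\<Sum>k\<in>UNIV. M $ k * x $ k) = M \<bullet> x" for x by (simp add: inner_vec_def)
  show ?thesis
  proof (cases "v t = 0")
    case False
    have Cz: "(\<Sum>k\<in>UNIV. C i j k * z $ k) = v t * ((G *v z) $ i * M $ j + (G *v z) $ j * M $ i) / (2 * S)" for i j
    proof -
      have "(\<Sum>k\<in>UNIV. C i j k * z $ k) = (v t * (H y i j * (\<Sum>k\<in>UNIV. M $ k * z $ k)
          + (\<Sum>k\<in>UNIV. H y i k * z $ k) * M $ j + (\<Sum>k\<in>UNIV. H y j k * z $ k) * M $ i)
        + w2 t * (M $ i * M $ j * (\<Sum>k\<in>UNIV. M $ k * z $ k))) / (2 * S)"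
        unfolding sum_distrib_left sum_distrib_right sum.distrib[symmetric] sum_divide_distrib C
        by (intro sum.cong refl) (simp add: field_simps)
      then show ?thesis unfolding sumM H_apply by (simp add: z)
    qed
    define cz where "cz = (\<Sum>k\<in>UNIV. c k * z $ k)"
    \<comment> \<open>The \<open>C2\<close>-like equation contracted with \<open>z\<close> once, twice and three times.\<close>
    have 1: "N * (v t * ((G *v z) $ i * M $ j + (G *v z) $ j * M $ i) / (2 * S)) = c i * c j * cz" for i j
      unfolding Cz[symmetric] cz_def sum_distrib_left mult.assoc[symmetric] C2 ..
    have 2: "N * (v t * (M $ i * (z \<bullet> (G *v z))) / (2 * S)) = c i * cz * cz" for i
    proof -
      have "c i * cz * cz = (\<Sum>j\<in>UNIV. c i * c j * cz * z $ j)"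
        unfolding cz_def[symmetric] by (subst (2) cz_def) (simp add: sum_distrib_left mult_ac)
      also have "\<dots> = N * (v t * ((G *v z) $ i * (\<Sum>j\<in>UNIV. M $ j * z $ j)
          + (\<Sum>j\<in>UNIV. (G *v z) $ j * z $ j) * M $ i) / (2 * S))"
        unfolding 1[symmetric] sum_distrib_left sum_distrib_right sum.distrib[symmetric] sum_divide_distrib
        by (intro sum.cong refl) (simp add: field_simps)
      also have "\<dots> = N * (v t * (M $ i * (z \<bullet> (G *v z))) / (2 * S))"
        unfolding sumM by (simp add: z) (simp add: inner_vec_def mult_ac)
      finally show ?thesis ..
    qed
    have "cz * cz * cz = (\<Sum>i\<in>UNIV. c i * cz * cz * z $ i)"
      by (subst (3) cz_def) (simp add: sum_distrib_left mult_ac)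
    also have "\<dots> = N * (v t * ((\<Sum>i\<in>UNIV. M $ i * z $ i) * (z \<bullet> (G *v z))) / (2 * S))"
      unfolding 2[symmetric] sum_distrib_left sum_distrib_right sum_divide_distrib
      by (intro sum.cong refl) (simp add: field_simps)
    also have "\<dots> = 0" unfolding sumM by (simp add: z)
    finally have "cz = 0" by simp
    moreover have "M \<noteq> 0" using MM' m2_pos by auto
    then obtain i where "M $ i \<noteq> 0" by (auto simp: vec_eq_iff)
    ultimately have "N = 0"
      using 2[of i] False zGz S by simp
    have c0: "c i = 0" for i
    proof -
      define c' where "c' = (\<chi> i. c i)"
      have "N = c' \<bullet> (matrix_inv g *v c')"
        by (simp add: N_def c'_def inner_matrix_vector mult_ac)
      moreover have "c' = g *v (matrix_inv g *v c')"
        by (simp add: matrix_vector_mul_assoc matrix_inv_right[OF g_inv])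
      ultimately have "matrix_inv g *v c' = 0"
        using g_pos[of "matrix_inv g *v c'"] \<open>N = 0\<close> by (metis inner_commute less_irrefl)
      then have "c' = 0" using \<open>c' = g *v (matrix_inv g *v c')\<close> by simp
      then show ?thesis by (simp add: c'_def vec_eq_iff)
    qed
    define \<mu> where "\<mu> = w1 t - (w t)\<^sup>2 / h t"
    \<comment> \<open>Here \<open>\<mu>\<close> is what completing the square in \<open>l\<close> leaves over from \<open>w1\<close>.\<close>
    have uH: "u t * H y j k = g $ j $ k - l $ j * l $ k / (h t * S\<^sup>2) - \<mu> * (M $ j * M $ k)" for j k
      using S h_pos unfolding g l H \<mu>_def u_def
      by (simp add: field_simps power2_eq_square)
    have CM': "(\<Sum>i\<in>UNIV. C i j k * M' $ i)
        = (v t * (2 * (M $ j * M $ k) + m2 * H y j k) + w2 t * m2 * (M $ j * M $ k)) / (2 * S)" for j k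
    proof -
      have "(\<Sum>i\<in>UNIV. C i j k * M' $ i) = (v t * ((\<Sum>i\<in>UNIV. H y j i * M' $ i) * M $ k
          + (\<Sum>i\<in>UNIV. H y k i * M' $ i) * M $ j + H y j k * (\<Sum>i\<in>UNIV. M $ i * M' $ i))
        + w2 t * (M $ j * M $ k * (\<Sum>i\<in>UNIV. M $ i * M' $ i))) / (2 * S)"
        unfolding sum_distrib_left sum_distrib_right sum.distrib[symmetric] sum_divide_distrib C
        by (intro sum.cong refl) (simp add: field_simps H_sym)
      then show ?thesis unfolding sumM H_apply by (simp add: GM' YM' MM' algebra_simps)
    qed
    have "0 = (\<Sum>i\<in>UNIV. c i * M' $ i)" by (simp add: c0)
    also have "\<dots> = (\<Sum>j\<in>UNIV. \<Sum>k\<in>UNIV. (\<Sum>i\<in>UNIV. C i j k * M' $ i) * matrix_inv g $ j $ k)"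
      unfolding c_def sum_distrib_right
      by (subst sum.swap, rule sum.cong[OF refl], subst sum.swap) (simp add: mult_ac)
    finally have "0 = 2 * S * u t * (\<Sum>j\<in>UNIV. \<Sum>k\<in>UNIV. (\<Sum>i\<in>UNIV. C i j k * M' $ i) * matrix_inv g $ j $ k)"
      by simp
    also have "\<dots> = (v t * m2) * (\<Sum>j\<in>UNIV. \<Sum>k\<in>UNIV. g $ j $ k * matrix_inv g $ j $ k)
        - v t * m2 / (h t * S\<^sup>2) * (\<Sum>j\<in>UNIV. \<Sum>k\<in>UNIV. l $ j * l $ k * matrix_inv g $ j $ k)
        + (2 * u t * v t - v t * m2 * \<mu> + u t * w2 t * m2) * (\<Sum>j\<in>UNIV. \<Sum>k\<in>UNIV. M $ j * M $ k * matrix_inv g $ j $ k)"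
      unfolding sum_distrib_left sum.distrib[symmetric] sum_subtractf[symmetric]
    proof (intro sum.cong refl)
      fix j k
      \<comment> \<open>The factor \<open>u\<close> is there because only \<open>u H\<close>, not \<open>H\<close>, decomposes as above.\<close>
      have "2 * S * u t * ((\<Sum>i\<in>UNIV. C i j k * M' $ i) * matrix_inv g $ j $ k)
        = (2 * u t * v t * (M $ j * M $ k) + v t * m2 * (u t * H y j k) + u t * w2 t * m2 * (M $ j * M $ k)) * matrix_inv g $ j $ k"
        unfolding CM' using S by (simp add: field_simps)
      then show "2 * S * u t * ((\<Sum>i\<in>UNIV. C i j k * M' $ i) * matrix_inv g $ j $ k)
        = v t * m2 * (g $ j $ k * matrix_inv g $ j $ k)
          - v t * m2 / (h t * S\<^sup>2) * (l $ j * l $ k * matrix_inv g $ j $ k)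
          + (2 * u t * v t - v t * m2 * \<mu> + u t * w2 t * m2) * (M $ j * M $ k * matrix_inv g $ j $ k)"
        unfolding uH by (simp add: algebra_simps)
    qed
    also have "(\<Sum>j\<in>UNIV. \<Sum>k\<in>UNIV. g $ j $ k * matrix_inv g $ j $ k) = CARD('n)"
      by (rule contract_matrix_inv[OF g_sym g_inv])
    also have "(\<Sum>j\<in>UNIV. \<Sum>k\<in>UNIV. l $ j * l $ k * matrix_inv g $ j $ k) = h t * S\<^sup>2"
      unfolding contract_rank_one using ly inv_apply[of y] by (simp add: l_def)
    also have "(\<Sum>j\<in>UNIV. \<Sum>k\<in>UNIV. M $ j * M $ k * matrix_inv g $ j $ k) = m2 / D"
    proof -
      have "matrix_inv g *v M = (1 / D) *\<^sub>R e"
        using inv_apply[of "(1 / D) *\<^sub>R e"] D_pos by (simp add: matrix_vector_mult_scaleR ge)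
      then show ?thesis unfolding contract_rank_one by (simp add: Me)
    qed
    finally have "0 = (v t * (real CARD('n) - 1) * D + (2 * u t * v t - v t * m2 * \<mu> + u t * w2 t * m2)) * (m2 / D)"
      using S h_pos D_pos by (simp add: field_simps)
    then have "v t * (real CARD('n) - 1) * D + (2 * u t * v t - v t * m2 * \<mu> + u t * w2 t * m2) = 0"
      using m2_pos D_pos by simp
    moreover have "v t * m2 * \<mu> = v t * D - v t * u t" by (simp add: D_def \<mu>_def algebra_simps)
    ultimately have "v t * ((real CARD('n) - 2) * D + 3 * u t) + u t * (m2 * w2 t) = 0"
      by (simp add: algebra_simps)
    then have "(3 + (real CARD('n) - 2) * D / u t) * v t + m2 * w2 t = 0"
      using u_pos by (simp add: field_simps)
    moreover have "3 + (real CARD('n) - 2) * D / u t \<ge> 3"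
      using n D_pos u_pos by simp
    ultimately show ?thesis unfolding m2_def t_def by blast
  qed (simp add: t_def)
qed

lemma b_bs_pos: "b \<noteq> 0 \<Longrightarrow> b \<bullet> bs > 0"
  using G_pos[of bs] by (cases "bs = 0") (auto simp: G_bs[symmetric] inner_commute)

lemma \<tau>_sq_le:
  assumes "y \<noteq> 0" shows "(\<tau> y)\<^sup>2 \<le> b \<bullet> bs"
proof -
  have "ms y \<bullet> (G *v ms y) \<ge> 0" using G_pos[of "ms y"] by (cases "ms y = 0") auto
  then show ?thesis using m_inner_ms[OF assms] by (simp add: G_ms inner_commute)
qed

text \<open>The slope takes every value between its bounds, the extreme ones in the directions of \<open>\<plusminus> bs\<close>;
so an identity that holds for all directions holds on the whole interval.\<close>

lemma \<tau>_attains: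
  assumes n: "CARD('n) \<ge> 3" and b: "b \<noteq> 0" and x: "x\<^sup>2 \<le> b \<bullet> bs"
  obtains y where "y \<noteq> 0" "\<tau> y = x"
proof -
  define B2 where "B2 = b \<bullet> bs"
  have B2: "B2 > 0" using b_bs_pos[OF b] by (simp add: B2_def)
  obtain z where z: "z \<noteq> 0" "b \<bullet> z = 0" using exists_orthogonal_to_pair[OF n] by metis
  \<comment> \<open>The combination of \<open>bs\<close> with a vector in the kernel of \<open>b\<close> that has \<open>G\<close>-length one and slope \<open>x\<close>.\<close>
  define r where "r = sqrt ((1 - x\<^sup>2 / B2) / (z \<bullet> (G *v z)))"
  have r: "r\<^sup>2 * (z \<bullet> (G *v z)) = 1 - x\<^sup>2 / B2"
    using G_pos[OF z(1)] x B2 by (simp add: r_def B2_def)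
  define y where "y = (x / B2) *\<^sub>R bs + r *\<^sub>R z"
  have "y \<bullet> (G *v y) = (x / B2)\<^sup>2 * (bs \<bullet> (G *v bs)) + 2 * (x / B2) * r * (z \<bullet> (G *v bs)) + r\<^sup>2 * (z \<bullet> (G *v z))"
    by (simp add: y_def matrix_vector_right_distrib matrix_vector_mult_scaleR inner_add_left inner_add_right
        G_commute[of bs z] power2_eq_square algebra_simps)
  also have "\<dots> = 1"
    unfolding r using B2 z(2) by (simp add: G_bs inner_commute[of _ b] B2_def[symmetric] power2_eq_square)
  finally have q: "y \<bullet> (G *v y) = 1" .
  have "b \<bullet> y = x" using B2 z(2) by (simp add: y_def inner_add_right B2_def[symmetric])
  then have "\<tau> y = x" by (simp add: \<tau>_def s_def q)
  moreover have "y \<noteq> 0" using q by auto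
  ultimately show thesis using that by blast
qed

text \<open>The condition at a single direction only gives an alternative; that it holds in all directions
gives the differential inequality on the full interval \<open>[-B, B]\<close>, and with it rigidity.\<close>

lemma C2_like_imp_quadratic:
  assumes n: "CARD('n) \<ge> 3" and b: "b \<noteq> 0" and I: "open I" "continuous_on I w2"
    and g_pos: "\<And>y z. y \<noteq> 0 \<Longrightarrow> z \<noteq> 0 \<Longrightarrow> z \<bullet> (fundamental_tensor E y *v z) > 0"
    and C2: "\<And>y i j k. y \<noteq> 0 \<Longrightarrow>
      (let g' = matrix_inv (fundamental_tensor E y);
           c = \<lambda>i. \<Sum>j\<in>UNIV. \<Sum>k\<in>UNIV. cartan_tensor E y i j k * g' $ j $ k
       in (\<Sum>i\<in>UNIV. \<Sum>j\<in>UNIV. g' $ i $ j * c i * c j) * cartan_tensor E y i j k = c i * c j * c k)"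
    and y: "y \<noteq> 0"
  shows "cartan_tensor E y i j k = 0" and "w (\<tau> y) = w1 0 * \<tau> y"
    and "h (\<tau> y) = h 0 + w1 0 * (\<tau> y)\<^sup>2"
proof -
  define B where "B = sqrt (b \<bullet> bs)"
  have B: "B > 0" "B\<^sup>2 = b \<bullet> bs" using b_bs_pos[OF b] by (auto simp: B_def)
  have in_iff: "x \<in> {-B..B} \<longleftrightarrow> x\<^sup>2 \<le> b \<bullet> bs" for x
    using B abs_le_square_iff[of x B] by (auto simp: abs_le_iff)
  have "{-B..B} \<subseteq> I"
    using \<tau>_attains[OF n b] \<tau>_in_I in_iff by (metis subsetI)
  moreover have "w x - x * w1 x = 0 \<or> (\<exists>K\<ge>3. K * (w x - x * w1 x) + (B\<^sup>2 - x\<^sup>2) * w2 x = 0)"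
    if x: "-B < x" "x < B" for x
  proof -
    have "x\<^sup>2 < B\<^sup>2" using x B by (intro power2_strict_mono) auto
    moreover obtain z where z: "z \<noteq> 0" "\<tau> z = x"
      using \<tau>_attains[OF n b, of x] calculation B by auto
    ultimately show ?thesis
      using C2_like_ode[OF n z(1) _ g_pos[OF z(1)] C2[OF z(1), unfolded Let_def]] B
      by (simp add: z v_def)
  qed
  ultimately have *: "x \<in> {-B..B} \<Longrightarrow> w x - x * w1 x = 0" "x \<in> {-B..B} \<Longrightarrow> w2 x = 0"
    "x \<in> {-B..B} \<Longrightarrow> w x = w1 0 * x" "x \<in> {-B..B} \<Longrightarrow> h x = h 0 + w1 0 * x\<^sup>2" for x
    using ode_forces_quadratic[OF B(1) I(1) _ h w w1 I(2)] by blast+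
  have \<tau>: "\<tau> y \<in> {-B..B}" using \<tau>_sq_le[OF y] in_iff by blast
  show "cartan_tensor E y i j k = 0" using *(1,2)[OF \<tau>] by (simp add: cartan_tensor_E[OF y] v_def)
  show "w (\<tau> y) = w1 0 * \<tau> y" "h (\<tau> y) = h 0 + w1 0 * (\<tau> y)\<^sup>2" using *(3,4)[OF \<tau>] by blast+
qed

end

section \<open>Charts and tangent vectors\<close>

context
  fixes X :: "'a topology" and A :: "('a, 'n::finite) chart set"
  assumes mfd: "smooth_manifold X A"
begin

lemma openin_chart: "c \<in> A \<Longrightarrow> openin X (fst c)"
  using mfd unfolding smooth_manifold_def by blast

lemma chart_homeomorphic:
  "c \<in> A \<Longrightarrow> homeomorphic_map (subtopology X (fst c)) (top_of_set (snd c ` fst c)) (snd c)"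
  using mfd unfolding smooth_manifold_def by blast

lemma chart_inj_on:
  assumes "c \<in> A" shows "inj_on (snd c) (fst c)"
  using homeomorphic_imp_injective_map[OF chart_homeomorphic[OF assms]]
    topspace_subtopology_subset[OF openin_subset[OF openin_chart[OF assms]]] by simp

lemma chart_inverse: "c \<in> A \<Longrightarrow> p \<in> fst c \<Longrightarrow> inv_into (fst c) (snd c) (snd c p) = p"
  by (simp add: chart_inj_on inv_into_f_f)

lemma open_chart_image:
  assumes "c \<in> A" "openin X U" "U \<subseteq> fst c"
  shows "open (snd c ` U)"
proof -
  have "openin (subtopology X (fst c)) U"
    using assms(2,3) by (simp add: openin_open_subtopology[OF openin_chart[OF assms(1)]])
  then have "openin (top_of_set (snd c ` fst c)) (snd c ` U)"
    using homeomorphic_imp_open_map[OF chart_homeomorphic[OF assms(1)]] by (simp add: open_map_def)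
  moreover have "open (snd c ` fst c)"
    using mfd assms(1) unfolding smooth_manifold_def by blast
  ultimately show ?thesis by (simp add: openin_open_eq)
qed

lemma chart_subset: "c \<in> A \<Longrightarrow> p \<in> fst c \<Longrightarrow> p \<in> topspace X"
  using openin_chart openin_subset by blast

lemma transition_apply: "c \<in> A \<Longrightarrow> p \<in> fst c \<Longrightarrow> transition c d (snd c p) = snd d p"
  by (simp add: transition_def chart_inverse)

lemma transition_has_derivative:
  assumes "c \<in> A" "d \<in> A" "p \<in> fst c" "p \<in> fst d"
  shows "(transition c d has_derivative frechet_derivative (transition c d) (at (snd c p))) (at (snd c p))"
proof (rule smooth_on_has_derivative)
  show "smooth_on (snd c ` (fst c \<inter> fst d)) (transition c d)"
    using mfd assms unfolding smooth_manifold_def by blast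
  show "open (snd c ` (fst c \<inter> fst d))"
    by (rule open_chart_image) (use assms in \<open>auto intro!: openin_Int openin_chart\<close>)
qed (use assms in auto)

text \<open>The chain rule for transition maps; it says that the components \<open>mk_tvec\<close> computes in the various
charts fit together to a tangent vector.\<close>

lemma transition_chain_rule:
  assumes "c \<in> A" "d \<in> A" "e \<in> A" "p \<in> fst c" "p \<in> fst d" "p \<in> fst e"
  shows "frechet_derivative (transition c e) (at (snd c p)) y =
    frechet_derivative (transition d e) (at (snd d p)) (frechet_derivative (transition c d) (at (snd c p)) y)"
proof -
  let ?U = "fst c \<inter> fst d \<inter> fst e"
  have "((\<lambda>x. transition d e (transition c d x)) has_derivative
      (\<lambda>y. frechet_derivative (transition d e) (at (snd d p)) (frechet_derivative (transition c d) (at (snd c p)) y)))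
      (at (snd c p))"
    using assms
    by (intro has_derivative_compose[OF transition_has_derivative]) (auto simp: transition_apply transition_has_derivative)
  then have "(transition c e has_derivative
      (\<lambda>y. frechet_derivative (transition d e) (at (snd d p)) (frechet_derivative (transition c d) (at (snd c p)) y)))
      (at (snd c p))"
  proof (rule has_derivative_transform_within_open)
    show "open (snd c ` ?U)"
      by (rule open_chart_image) (use assms in \<open>auto intro!: openin_Int openin_chart\<close>)
  qed (use assms in \<open>auto simp: transition_apply\<close>)
  from fun_cong[OF frechet_derivative_at[OF this], of y] show ?thesis by simp
qed

lemma transition_self:
  assumes "c \<in> A" "p \<in> fst c"
  shows "frechet_derivative (transition c c) (at (snd c p)) y = y"
proof -
  have "(transition c c has_derivative (\<lambda>y. y)) (at (snd c p))"
  proof (rule has_derivative_transform_within_open[OF has_derivative_ident])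
    show "open (snd c ` fst c)"
      by (rule open_chart_image) (use assms in \<open>auto intro!: openin_Int openin_chart\<close>)
  qed (use assms in \<open>auto simp: transition_apply\<close>)
  from fun_cong[OF frechet_derivative_at[OF this], of y] show ?thesis by simp
qed

lemma mk_tvec_at_chart: "c \<in> A \<Longrightarrow> p \<in> fst c \<Longrightarrow> mk_tvec A c p y c = y"
  by (simp add: mk_tvec_def transition_self)

lemma mk_tvec_in_tangent_space:
  assumes "c \<in> A" "p \<in> fst c"
  shows "mk_tvec A c p y \<in> tangent_space A p"
  using assms by (auto simp: tangent_space_def mk_tvec_def intro!: transition_chain_rule[OF assms(1) _ _ assms(2)])

text \<open>A tangent vector is determined by its components in one chart, so statements about the tangent
bundle may be checked on fibres \<open>real^'n\<close>.\<close>

lemma mk_tvec_components: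
  assumes "c \<in> A" "p \<in> fst c" "v \<in> tangent_space A p"
  shows "mk_tvec A c p (v c) = v"
proof
  fix d
  show "mk_tvec A c p (v c) d = v d"
  proof (cases "d \<in> A \<and> p \<in> fst d")
    case True
    then have "v d = frechet_derivative (transition c d) (at (snd c p)) (v c)"
      using assms unfolding tangent_space_def by blast
    with True show ?thesis by (simp only: mk_tvec_def) simp
  next
    case False
    then have "v d = 0" using assms(3) unfolding tangent_space_def by blast
    with False show ?thesis by (auto simp: mk_tvec_def)
  qed
qed

lemma mk_tvec_scaleR:
  assumes "c \<in> A" "p \<in> fst c"
  shows "mk_tvec A c p (r *\<^sub>R y) = (\<lambda>d. r *\<^sub>R mk_tvec A c p y d)"
  using assms has_derivative_linear[OF transition_has_derivative[OF assms(1) _ assms(2)]]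
  by (auto simp: mk_tvec_def linear_scale)

lemma mk_tvec_tangent_bundle: "c \<in> A \<Longrightarrow> p \<in> fst c \<Longrightarrow> (p, mk_tvec A c p y) \<in> tangent_bundle X A"
  by (simp add: tangent_bundle_def mk_tvec_in_tangent_space chart_subset)

lemma mk_tvec_slit_bundle:
  assumes "c \<in> A" "p \<in> fst c" "y \<noteq> 0"
  shows "(p, mk_tvec A c p y) \<in> slit_bundle X A"
  using assms mk_tvec_at_chart[OF assms(1,2), of y]
  by (auto simp: slit_bundle_def mk_tvec_tangent_bundle)

lemma tangent_bundle_cases:
  assumes "(p, v) \<in> tangent_bundle X A"
  obtains c y where "c \<in> A" "p \<in> fst c" "v = mk_tvec A c p y"
proof -
  have "p \<in> (\<Union>c\<in>A. fst c)"
    using assms mfd by (simp add: tangent_bundle_def smooth_manifold_def)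
  then obtain c where "c \<in> A" "p \<in> fst c" by blast
  then show thesis
    using that[of c "v c"] mk_tvec_components[of c p v] assms by (simp add: tangent_bundle_def)
qed

end

lemma finsler_fibre:
  assumes F: "finsler X A L" and c: "c \<in> A" "p \<in> fst c"
  shows "r \<ge> 0 \<Longrightarrow> fibre A L c p (r *\<^sub>R y) = r * fibre A L c p y"
    and "y \<noteq> 0 \<Longrightarrow> fibre A L c p y > 0"
    and "smooth_on (-{0}) (fibre A L c p)"
proof -
  have mfd: "smooth_manifold X A" using F by (simp add: finsler_def)
  show "fibre A L c p (r *\<^sub>R y) = r * fibre A L c p y" if "r \<ge> 0"
    using F that mk_tvec_tangent_bundle[OF mfd c, of y]
    unfolding fibre_def mk_tvec_scaleR[OF mfd c] finsler_def by blast
  show "fibre A L c p y > 0" if "y \<noteq> 0"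
    using F mk_tvec_slit_bundle[OF mfd c that] unfolding fibre_def finsler_def by blast
  let ?S = "(snd c ` fst c) \<times> (-{0 :: real^_})"
  have "smooth_on {(x, y). x \<in> snd c ` fst c \<and> y \<noteq> 0} (local_expr A L c)"
    using F c unfolding finsler_def by blast
  also have "{(x, y). x \<in> snd c ` fst c \<and> y \<noteq> 0} = ?S" by auto
  finally have sm: "smooth_on ?S (local_expr A L c)" .
  have "open (snd c ` fst c)"
    by (rule open_chart_image[OF mfd c(1) openin_chart[OF mfd c(1)]]) simp
  then have "open ?S" by (intro open_Times) auto
  from smooth_on_slice[OF this sm, of "snd c p"] c show "smooth_on (-{0}) (fibre A L c p)"
    by (simp add: local_expr_def chart_inverse[OF mfd c] Compl_eq)
qed

lemma one_form_fibre:
  assumes "smooth_manifold X A" "one_form A \<beta>" and c: "c \<in> A" "p \<in> fst c"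
  shows "fibre A \<beta> c p y = b_comp A \<beta> c p \<bullet> y"
proof -
  obtain b where "\<And>x y. x \<in> snd c ` fst c \<Longrightarrow> local_expr A \<beta> c (x, y) = b x \<bullet> y"
    using assms unfolding one_form_def by blast
  from this[of "snd c p"] c have "fibre A \<beta> c p y = b (snd c p) \<bullet> y" for y
    by (simp add: local_expr_def chart_inverse[OF assms(1) c])
  moreover from this have "b_comp A \<beta> c p = b (snd c p)"
    by (simp add: b_comp_def vec_eq_iff inner_axis)
  ultimately show ?thesis by simp
qed

lemma g_tensor_eq: "g_tensor A L c p = fundamental_tensor (\<lambda>z. (fibre A L c p z)\<^sup>2)"
  by (simp add: fun_eq_iff g_tensor_def fundamental_tensor_def)

lemma cartan_eq: "cartan A L c p = cartan_tensor (\<lambda>z. (fibre A L c p z)\<^sup>2)"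
  by (simp add: fun_eq_iff cartan_def cartan_tensor_def g_tensor_eq)

section \<open>The generalized change on one fibre and the theorem\<close>

text \<open>The derivatives of the profile are parameters that do not depend on the point. This makes the
constants \<open>(f 1 0)\<^sup>2\<close> and \<open>w1 0\<close> of the conclusion global, although connectedness is not assumed.
The last conclusion is stated with the scale \<open>S = e\<^sup>\<sigma> L\<close> and the slope \<open>x = \<beta> / S\<close>.\<close>

lemma gen_beta_conformal_change_fibre:
  fixes X :: "'a topology" and A :: "('a, 'n::finite) chart set"
    and L L' \<beta> :: "('a, 'n) tb_fun" and \<sigma> :: "'a \<Rightarrow> real" and f :: "real \<Rightarrow> real \<Rightarrow> real"
    and W :: "(real \<times> real) set" and w1 w2 :: "real \<Rightarrow> real"
  assumes riem: "riemannian X A L"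
    and change: "gen_beta_conformal_change X A \<sigma> \<beta> W f L L'"
    and stand: "standing_assumptions A \<sigma> \<beta> f L"
    and C2: "C2_like X A L'" and n: "CARD('n) \<noteq> 2"
  defines "I \<equiv> {x. (1, x) \<in> W}"
  assumes \<phi>: "\<And>x. x \<in> I \<Longrightarrow> (f 1 has_real_derivative \<phi>1 x) (at x)"
    and w: "\<And>x. x \<in> I \<Longrightarrow> ((\<lambda>x. f 1 x * \<phi>1 x) has_real_derivative w1 x) (at x)"
    and w1: "\<And>x. x \<in> I \<Longrightarrow> (w1 has_real_derivative w2 x) (at x)" and w2: "continuous_on I w2"
    and c: "c \<in> A" "p \<in> fst c"
  shows "f 1 0 \<noteq> 0"
    and "y \<noteq> 0 \<Longrightarrow> cartan A L' c p y i j k = 0"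
    and "y \<noteq> 0 \<Longrightarrow> S = exp (\<sigma> p) * fibre A L c p y \<Longrightarrow> x = fibre A \<beta> c p y / S \<Longrightarrow>
      S > 0 \<and> x \<in> I \<and> (S, S * x) \<in> W \<and> fibre A L' c p y = S * f 1 x \<and> f 1 x > 0 \<and>
      f 1 x * \<phi>1 x = w1 0 * x \<and> (f 1 x)\<^sup>2 = (f 1 0)\<^sup>2 + w1 0 * x\<^sup>2"
proof -
  have n3: "CARD('n) \<ge> 3" using C2 n unfolding C2_like_def by auto
  have fin: "finsler X A L" "finsler X A L'" using change by (auto simp: gen_beta_conformal_change_def)
  have mfd: "smooth_manifold X A" using fin by (simp add: finsler_def)
  define b where "b = b_comp A \<beta> c p"
  have \<beta>: "fibre A \<beta> c p y = b \<bullet> y" for y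
    using one_form_fibre[OF mfd _ c] change by (simp add: gen_beta_conformal_change_def b_def)
  note FL = finsler_fibre[OF fin(1) c] and FL' = finsler_fibre[OF fin(2) c]
  obtain G0 where G0: "\<And>y. y \<noteq> 0 \<Longrightarrow> g_tensor A L c p y = G0"
    "\<And>y. (fibre A L c p y)\<^sup>2 = y \<bullet> (G0 *v y)" "transpose G0 = G0"
  proof (rule Riemannian_fibre_quadratic[OF _ FL(3) FL(1)])
    show "cartan_tensor (\<lambda>z. (fibre A L c p z)\<^sup>2) y i j k = 0" if "y \<noteq> 0" for y i j k
      using riem c that unfolding riemannian_def cartan_eq by blast
  qed (use n3 in \<open>auto simp: g_tensor_eq\<close>)
  define G where "G = (exp (\<sigma> p))\<^sup>2 *\<^sub>R G0"
  have G_quad: "y \<bullet> (G *v y) = (exp (\<sigma> p) * fibre A L c p y)\<^sup>2" for y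
    by (simp add: G_def G0(2) power_mult_distrib scaleR_matrix_vector_assoc[symmetric])
  have G_pos: "z \<bullet> (G *v z) > 0" if "z \<noteq> 0" for z
    using FL(2)[OF that] unfolding G_quad by simp
  have G_sym: "transpose G = G"
    using G0(3) by (simp add: G_def transpose_def vec_eq_iff)
  have "invertible G" by (rule positive_definite_invertible[OF G_pos])
  then have bs: "G *v (matrix_inv G *v b) = b"
    by (simp add: matrix_vector_mul_assoc matrix_inv_right)
  have b: "b \<noteq> 0"
  proof
    \<comment> \<open>If \<open>b = 0\<close> then \<open>m = 0\<close>, and no \<open>y \<noteq> 0\<close> is a multiple of the raised \<open>b\<close>.\<close>
    assume b0: "b = 0"
    define e where "e = (axis undefined 1 :: real^'n)"
    have e: "e \<noteq> 0" by (simp add: e_def axis_eq_0_iff)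
    have "\<nexists>r. e = r *\<^sub>R (g_inv A L c p e *v b_comp A \<beta> c p)"
      using e b0 by (simp add: b_def[symmetric])
    then have "m_form A L \<beta> c p e \<noteq> 0"
      using stand c e unfolding standing_assumptions_def by blast
    then show False using b0 by (simp add: m_form_def \<beta> b_def[symmetric])
  qed
  have val: "(s, b \<bullet> y) \<in> W" "fibre A L' c p y = f s (b \<bullet> y)"
    if "y \<noteq> 0" "s = exp (\<sigma> p) * fibre A L c p y" for y s
    using change mk_tvec_slit_bundle[OF mfd c that(1)] \<beta>[of y] that(2)
    unfolding gen_beta_conformal_change_def L_tilde_def fibre_def by auto
  have hom: "(r * s, r * t) \<in> W" "f (r * s) (r * t) = r * f s t" if "(s, t) \<in> W" "r > 0" for r s t
    using change that unfolding gen_beta_conformal_change_def by blast+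
  have ratio: "(1, b \<bullet> y / s) \<in> W" "f s (b \<bullet> y) = s * f 1 (b \<bullet> y / s)"
    if "y \<noteq> 0" "s = exp (\<sigma> p) * fibre A L c p y" for y s
  proof -
    have s: "s > 0" using FL(2)[OF that(1)] that(2) by simp
    show 1: "(1, b \<bullet> y / s) \<in> W" using hom(1)[OF val(1)[OF that], of "1 / s"] s by simp
    show "f s (b \<bullet> y) = s * f 1 (b \<bullet> y / s)" using hom(2)[OF 1 s] s by simp
  qed
  have sqrt_G: "sqrt (y \<bullet> (G *v y)) = exp (\<sigma> p) * fibre A L c p y" if "y \<noteq> 0" for y
    using FL(2)[OF that] unfolding G_quad by (simp add: less_imp_le)
  define h where "h = (\<lambda>x. (f 1 x)\<^sup>2)"
  interpret beta_fibre G b "matrix_inv G *v b" I h "\<lambda>x. f 1 x * \<phi>1 x" w1 w2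
  proof
    show "(h has_real_derivative 2 * (f 1 x * \<phi>1 x)) (at x)" if "x \<in> I" for x
      unfolding h_def using \<phi>[OF that] by (auto intro!: derivative_eq_intros)
    show "b \<bullet> y / sqrt (y \<bullet> (G *v y)) \<in> I" if "y \<noteq> 0" for y
      using ratio(1)[OF that refl] by (simp add: I_def sqrt_G[OF that])
  qed (fact G_sym G_pos bs w w1)+
  have s_eq: "s y = exp (\<sigma> p) * fibre A L c p y" if "y \<noteq> 0" for y
    by (simp add: s_def sqrt_G[OF that])
  have E_eq: "(fibre A L' c p z)\<^sup>2 = E z" if "z \<in> -{0}" for z
    unfolding E_def using that val(2)[of z] ratio(2)[of z]
    by (simp add: h_def s_eq \<tau>_def power_mult_distrib)
  have opn: "open (-{0 :: real^'n})" by auto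
  have g': "g_tensor A L' c p y = fundamental_tensor E y" if "y \<noteq> 0" for y
    unfolding g_tensor_eq by (rule fundamental_tensor_cong[OF opn _ E_eq]) (use that in auto)
  have cartan': "cartan A L' c p y i j k = cartan_tensor E y i j k" if "y \<noteq> 0" for y i j k
    unfolding cartan_eq by (rule cartan_tensor_cong[OF opn _ E_eq]) (use that in auto)
  have openI: "open I"
    using change open_vimage[of W "Pair 1"]
    unfolding gen_beta_conformal_change_def I_def by (auto simp: vimage_def continuous_intros)
  have g_pos: "z \<bullet> (fundamental_tensor E y *v z) > 0" if "y \<noteq> 0" "z \<noteq> 0" for y z
    using fin(2) c that unfolding g'[OF that(1), symmetric] finsler_def by blast
  have C2': "let g' = matrix_inv (fundamental_tensor E y);
           c = \<lambda>i. \<Sum>j\<in>UNIV. \<Sum>k\<in>UNIV. cartan_tensor E y i j k * g' $ j $ k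
       in (\<Sum>i\<in>UNIV. \<Sum>j\<in>UNIV. g' $ i $ j * c i * c j) * cartan_tensor E y i j k = c i * c j * c k"
    if "y \<noteq> 0" for y i j k
  proof -
    have "norm_sq A L' c p y (cartan_vec A L' c p y) * cartan A L' c p y i j k =
        cartan_vec A L' c p y $ i * cartan_vec A L' c p y $ j * cartan_vec A L' c p y $ k"
      using C2 c that unfolding C2_like_def by blast
    then show ?thesis
      by (simp add: norm_sq_def cartan_vec_def g_inv_def g'[OF that] cartan'[OF that] Let_def)
  qed
  have quadratic: "cartan_tensor E y i j k = 0" "f 1 (\<tau> y) * \<phi>1 (\<tau> y) = w1 0 * \<tau> y"
    "h (\<tau> y) = h 0 + w1 0 * (\<tau> y)\<^sup>2" if "y \<noteq> 0" for y i j k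
    by (rule C2_like_imp_quadratic[OF n3 b openI w2]; (rule g_pos C2' that; assumption?))+
  have f_pos: "f 1 (\<tau> y) > 0" if "y \<noteq> 0" for y
    using FL'(2)[OF that] val(2)[OF that refl] ratio(2)[OF that refl] s_eq[OF that] s_pos[OF that]
    by (simp add: \<tau>_def zero_less_mult_iff)
  show "cartan A L' c p y i j k = 0" if "y \<noteq> 0"
    using quadratic(1)[OF that] that cartan' by simp
  obtain z where "z \<noteq> 0" "\<tau> z = 0"
    using \<tau>_attains[OF n3 b, of 0] b_bs_pos[OF b] by auto
  then show "f 1 0 \<noteq> 0" using f_pos by force
  show "S > 0 \<and> x \<in> I \<and> (S, S * x) \<in> W \<and> fibre A L' c p y = S * f 1 x \<and> f 1 x > 0 \<and>
      f 1 x * \<phi>1 x = w1 0 * x \<and> (f 1 x)\<^sup>2 = (f 1 0)\<^sup>2 + w1 0 * x\<^sup>2"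
    if y: "y \<noteq> 0" and S: "S = exp (\<sigma> p) * fibre A L c p y" and x: "x = fibre A \<beta> c p y / S"
  proof -
    have x': "x = \<tau> y" by (simp add: \<tau>_def s_eq[OF y] x S \<beta>)
    have "S > 0" using s_pos[OF y] by (simp add: S s_eq[OF y])
    then have "S * x = b \<bullet> y" by (simp add: x \<beta>)
    then show ?thesis
      using \<open>S > 0\<close> val[OF y S] ratio[OF y S] f_pos[OF y] quadratic(2,3)[OF y] \<tau>_in_I[OF y]
      by (simp add: x'[symmetric] x[symmetric, unfolded \<beta>] h_def)
  qed
qed

theorem theorem2p20:
  fixes X :: "'a topology" and A :: "('a, 'n::finite) chart set"
    and L L' \<beta> :: "('a, 'n) tb_fun" and \<sigma> :: "'a \<Rightarrow> real"
    and W :: "(real \<times> real) set" and f :: "real \<Rightarrow> real \<Rightarrow> real"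
  assumes "riemannian X A L"
    and "gen_beta_conformal_change X A \<sigma> \<beta> W f L L'"
    and "depends_on_beta X A \<sigma> \<beta> f L"
    and "standing_assumptions A \<sigma> \<beta> f L"
    and "C2_like X A L'"
  shows "CARD('n) = 2 \<or> (energy_beta_change X A \<sigma> \<beta> L L' \<and> riemannian X A L')"
proof (cases "CARD('n) = 2")
  case n: False
  define I where "I = {x. (1, x) \<in> W}"
  have W: "open W" "smooth_on W (\<lambda>(s, t). f s t)"
    using assms(2) by (auto simp: gen_beta_conformal_change_def)
  have openI: "open I"
    using open_vimage[OF W(1), of "Pair 1"] unfolding I_def by (auto simp: vimage_def continuous_intros)
  have smf: "smooth_on I (f 1)"
    using smooth_on_slice[OF W, of 1] by (simp add: I_def)
  define D where "D = (\<lambda>(\<phi> :: real \<Rightarrow> real) x. frechet_derivative \<phi> (at x) 1)"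
  have D: "smooth_on I (D \<phi>)" "\<And>x. x \<in> I \<Longrightarrow> (\<phi> has_real_derivative D \<phi> x) (at x)"
    if "smooth_on I \<phi>" for \<phi>
    using smooth_on_partial[OF that, of 1] smooth_on_has_real_derivative[OF that openI] by (auto simp: D_def)
  define w where "w = (\<lambda>x. f 1 x * D (f 1) x)"
  have smw: "smooth_on I w"
    unfolding w_def by (intro smooth_on_mult openI smf D)
  note sm1 = D(1)[OF smw] and sm2 = D(1)[OF D(1)[OF smw]]
  have w: "((\<lambda>x. f 1 x * D (f 1) x) has_real_derivative D w x) (at x)" if "x \<in> I" for x
    using D(2)[OF smw that] unfolding w_def .
  have fibre_facts: "f 1 0 \<noteq> 0" "y \<noteq> 0 \<Longrightarrow> cartan A L' c p y i j k = 0"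
    "y \<noteq> 0 \<Longrightarrow> s = exp (\<sigma> p) * fibre A L c p y \<Longrightarrow> x = fibre A \<beta> c p y / s \<Longrightarrow>
      s > 0 \<and> x \<in> I \<and> (s, s * x) \<in> W \<and> fibre A L' c p y = s * f 1 x \<and> f 1 x > 0 \<and>
      f 1 x * D (f 1) x = D w 0 * x \<and> (f 1 x)\<^sup>2 = (f 1 0)\<^sup>2 + D w 0 * x\<^sup>2"
    if "c \<in> A" "p \<in> fst c" for c p y i j k s x
    using gen_beta_conformal_change_fibre[OF assms(1,2,4,5) n, folded I_def,
        of "D (f 1)" "D w" "D (D w)", OF D(2)[OF smf] w D(2)[OF sm1] smooth_on_imp_continuous_on[OF sm2] that]
    by simp_all
  have mfd: "smooth_manifold X A" and fin: "finsler X A L" "finsler X A L'"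
    using assms(2) by (auto simp: gen_beta_conformal_change_def finsler_def)
  obtain w0 where w0: "w0 \<in> slit_bundle X A" "f_2 f (L_tilde \<sigma> L w0) (\<beta> w0) \<noteq> 0"
    using assms(3) unfolding depends_on_beta_def by blast
  have slit: "\<exists>c y. c \<in> A \<and> p \<in> fst c \<and> y \<noteq> 0 \<and> v = mk_tvec A c p y"
    if pv: "(p, v) \<in> slit_bundle X A" for p v
  proof -
    have "(p, v) \<in> tangent_bundle X A" using pv by (simp add: slit_bundle_def)
    then obtain c y where cy: "c \<in> A" "p \<in> fst c" "v = mk_tvec A c p y"
      by (rule tangent_bundle_cases[OF mfd])
    moreover have "mk_tvec A c p 0 = (\<lambda>_. 0)"
      using mk_tvec_scaleR[OF mfd cy(1,2), of 0 0] by simp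
    then have "y \<noteq> 0" using pv cy(3) by (auto simp: slit_bundle_def)
    ultimately show ?thesis by blast
  qed
  obtain p v where pv: "w0 = (p, v)" by (cases w0)
  then obtain c y where cy: "c \<in> A" "p \<in> fst c" "y \<noteq> 0" "v = mk_tvec A c p y"
    using slit w0(1) by blast
  have f10: "(f 1 0)\<^sup>2 \<noteq> 0" using fibre_facts(1)[OF cy(1,2)] by simp
  have k: "D w 0 \<noteq> 0"
  proof
    \<comment> \<open>Then \<open>h' = 0\<close> at every slope, also at the extreme ones, so \<open>f\<^sub>2\<close> would vanish at every value of \<open>(e\<^sup>\<sigma> L, \<beta>)\<close>.\<close>
    assume k0: "D w 0 = 0"
    define s where "s = exp (\<sigma> p) * fibre A L c p y"
    define x where "x = fibre A \<beta> c p y / s"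
    note facts = fibre_facts(3)[OF cy(1-3) s_def x_def]
    have x: "x \<in> I" "s > 0" "(s, s * x) \<in> W" "D (f 1) x = 0" using facts k0 by auto
    have args: "L_tilde \<sigma> L w0 = s" "\<beta> w0 = s * x"
    proof -
      show "L_tilde \<sigma> L w0 = s" by (simp add: pv cy(4) L_tilde_def s_def fibre_def)
      have "\<beta> w0 = fibre A \<beta> c p y" by (simp add: pv cy(4) fibre_def)
      then show "\<beta> w0 = s * x" using x(2) unfolding x_def by simp
    qed
    define U where "U = {u. (s, u) \<in> W}"
    have "open U"
      using open_vimage[OF W(1), of "Pair s"] unfolding U_def by (auto simp: vimage_def continuous_intros)
    have hom: "f s u = s * f 1 (u / s)" if "u \<in> U" for u
    proof -
      have scale: "(r * a, r * b) \<in> W \<and> f (r * a) (r * b) = r * f a b" if "(a, b) \<in> W" "r > 0" for a b r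
        using assms(2) that unfolding gen_beta_conformal_change_def by blast
      have "(1, u / s) \<in> W" using scale[of s u "1 / s"] that x(2) by (simp add: U_def)
      then show ?thesis using scale[of 1 "u / s" s] x(2) by simp
    qed
    have "((\<lambda>u. s * f 1 (u / s)) has_real_derivative s * (D (f 1) x * (1 / s))) (at (s * x))"
    proof (rule DERIV_cmult, rule DERIV_chain2[where f = "f 1" and g = "\<lambda>u. u / s"])
      show "(f 1 has_real_derivative D (f 1) x) (at (s * x / s))"
        using D(2)[OF smf x(1)] x(2) by simp
      show "((\<lambda>u. u / s) has_real_derivative 1 / s) (at (s * x))"
        by (rule DERIV_cdivide[OF DERIV_ident])
    qed
    then have "((\<lambda>u. f s u) has_real_derivative s * (D (f 1) x * (1 / s))) (at (s * x))"
      by (rule has_field_derivative_transform_within_open[OF _ \<open>open U\<close>])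
        (use x(3) hom in \<open>auto simp: U_def\<close>)
    then have "f_2 f s (s * x) = 0" unfolding f_2_def by (simp add: DERIV_imp_deriv x(4))
    then show False using w0(2) by (simp add: args)
  qed
  have energy: "L' (p, v) = sqrt ((f 1 0)\<^sup>2 * exp (2 * \<sigma> p) * (L (p, v))\<^sup>2 + D w 0 * (\<beta> (p, v))\<^sup>2)"
    if "(p, v) \<in> tangent_bundle X A" for p v
  proof -
    obtain c y where cy: "c \<in> A" "p \<in> fst c" "v = mk_tvec A c p y"
      using tangent_bundle_cases[OF mfd \<open>(p, v) \<in> _\<close>] by blast
    have eqs: "L' (p, v) = fibre A L' c p y" "L (p, v) = fibre A L c p y" "\<beta> (p, v) = fibre A \<beta> c p y"
      by (simp_all add: fibre_def cy)
    show ?thesis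
    proof (cases "y = 0")
      case True
      have "one_form A \<beta>" using assms(2) by (simp add: gen_beta_conformal_change_def)
      then show ?thesis
        using True finsler_fibre(1)[OF fin(1) cy(1,2), of 0 0] finsler_fibre(1)[OF fin(2) cy(1,2), of 0 0]
          one_form_fibre[OF mfd _ cy(1,2), of \<beta> 0]
        by (simp add: eqs)
    next
      case False
      define s where "s = exp (\<sigma> p) * fibre A L c p y"
      define x where "x = fibre A \<beta> c p y / s"
      note facts = fibre_facts(3)[OF cy(1,2) False s_def x_def]
      have "(L' (p, v))\<^sup>2 = s\<^sup>2 * (f 1 x)\<^sup>2" using facts by (simp add: eqs power_mult_distrib)
      also have "\<dots> = s\<^sup>2 * ((f 1 0)\<^sup>2 + D w 0 * x\<^sup>2)" using facts by simp
      also have "\<dots> = (f 1 0)\<^sup>2 * s\<^sup>2 + D w 0 * (s * x)\<^sup>2" by (simp add: algebra_simps)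
      also have "s * x = \<beta> (p, v)" using facts by (simp add: x_def eqs)
      also have "s\<^sup>2 = exp (2 * \<sigma> p) * (L (p, v))\<^sup>2"
        by (simp add: s_def eqs power_mult_distrib exp_double)
      finally have "(L' (p, v))\<^sup>2 = (f 1 0)\<^sup>2 * exp (2 * \<sigma> p) * (L (p, v))\<^sup>2 + D w 0 * (\<beta> (p, v))\<^sup>2"
        by simp
      moreover have "L' (p, v) > 0" using finsler_fibre(2)[OF fin(2) cy(1,2) False] by (simp add: eqs)
      ultimately show ?thesis by (metis less_imp_le real_sqrt_unique)
    qed
  qed
  have "energy_beta_change X A \<sigma> \<beta> L L'"
    unfolding energy_beta_change_def using k f10 energy by (intro exI[of _ "D w 0"] exI[of _ "(f 1 0)\<^sup>2"]) auto
  moreover have "riemannian X A L'"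
    unfolding riemannian_def using fin(2) fibre_facts(2) by blast
  ultimately show ?thesis by simp
qed simp

end
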